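(* Let $X=X_2=\{\circ,\bullet\}$. Among the one-element subsets of the set $\mathcal{LT}_3(X)$ of tree patterns with three leaves there are exactly two Wilf equivalence classes, and among the two-element subsets of $\mathcal{LT}_3(X)$ there are exactly ten Wilf equivalence classes.
   Context: Trees are planar rooted binary trees whose internal vertices are each labelled $\circ$ or $\bullet$ and whose leaves are labelled bijectively by $\{1,\dots,l\}$ ($l$ = number of leaves) so that, assigning to each internal vertex the minimum label of its descendant leaves, the left child of each internal vertex has a smaller assigned number than its right child. $\mathcal{LT}_3(X)$ consists of the $12$ such trees with three leaves. A subtree of $T$ is a subtree $S$ rooted at an internal vertex of $T$ such that for every internal vertex of $S$ both its children in $T$ are in $S$ (with vertex labels inherited); its leaves carry the assigned integers and relabelling them order-preservingly by $1,\dots,l$ gives the standardisation $\mathrm{st}(S)$; $T$ avoids a set of patterns if no $\mathrm{st}(S)$ lies in the set. Two pattern sets are Wilf equivalent if for every $l$ the numbers of trees with $l$ leaves avoiding them coincide. *)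

theory Defs
  imports Main
begin

datatype 'x ltree = Leaf nat | Node 'x "'x ltree" "'x ltree"

fun leaves :: "'x ltree \<Rightarrow> nat list" where
  "leaves (Leaf i) = [i]"
| "leaves (Node x L R) = leaves L @ leaves R"

text \<open>For a leaf, \<open>assigned\<close> is its own label.\<close>
definition assigned :: "'x ltree \<Rightarrow> nat" where
  "assigned T = Min (set (leaves T))"

fun increasing :: "'x ltree \<Rightarrow> bool" where
  "increasing (Leaf i) = True"
| "increasing (Node x L R) \<longleftrightarrow> assigned L < assigned R \<and> increasing L \<and> increasing R"

definition LT :: "nat \<Rightarrow> 'x ltree set" where
  "LT l = {T. distinct (leaves T) \<and> set (leaves T) = {1..l} \<and> increasing T}"

text \<open>The subtrees of a tree with the same root: a vertex is either kept together with both
  its children, or it becomes a leaf carrying its assigned number. A tree without internal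
  vertices has no subtrees in the sense of \<open>subtrees\<close>, since these are rooted at internal
  vertices.\<close>
fun root_subtrees :: "'x ltree \<Rightarrow> 'x ltree set" where
  "root_subtrees (Leaf i) = {Leaf i}"
| "root_subtrees (Node x L R) =
     insert (Leaf (assigned (Node x L R)))
       {Node x L' R' | L' R'. L' \<in> root_subtrees L \<and> R' \<in> root_subtrees R}"

fun subtrees :: "'x ltree \<Rightarrow> 'x ltree set" where
  "subtrees (Leaf i) = {}"
| "subtrees (Node x L R) = root_subtrees (Node x L R) \<union> subtrees L \<union> subtrees R"

fun relabel :: "(nat \<Rightarrow> nat) \<Rightarrow> 'x ltree \<Rightarrow> 'x ltree" where
  "relabel f (Leaf i) = Leaf (f i)"
| "relabel f (Node x L R) = Node x (relabel f L) (relabel f R)"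

definition st :: "'x ltree \<Rightarrow> 'x ltree" where
  "st S = relabel (\<lambda>i. card {j \<in> set (leaves S). j \<le> i}) S"

definition avoids :: "'x ltree \<Rightarrow> 'x ltree set \<Rightarrow> bool" where
  "avoids T P \<longleftrightarrow> (\<forall>S \<in> subtrees T. st S \<notin> P)"

definition Wilf_equivalent :: "'x ltree set \<Rightarrow> 'x ltree set \<Rightarrow> bool" where
  "Wilf_equivalent P Q \<longleftrightarrow>
     (\<forall>l. card {T \<in> LT l. avoids T P} = card {T \<in> LT l. avoids T Q})"

definition Wilf_classes :: "'x ltree set set \<Rightarrow> 'x ltree set set set" where
  "Wilf_classes \<P> = \<P> // {(P, Q). P \<in> \<P> \<and> Q \<in> \<P> \<and> Wilf_equivalent P Q}"

datatype colour = White | Black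

text \<open>The cardinalities in \<open>Wilf_equivalent\<close> are those of finite sets when there are finitely
  many vertex labels.\<close>

lemma finite_ltree_bounded:
  "finite {T :: 'x::finite ltree. length (leaves T) \<le> n \<and> set (leaves T) \<subseteq> {1..l}}"
proof (induction n)
  case 0
  have "leaves T \<noteq> []" for T :: "'x ltree" by (induction T) auto
  then show ?case by simp
next
  case (Suc n)
  let ?A = "{T :: 'x ltree. length (leaves T) \<le> n \<and> set (leaves T) \<subseteq> {1..l}}"
  have ne: "Suc 0 \<le> length (leaves T)" for T :: "'x ltree" by (induction T) auto
  have "{T :: 'x ltree. length (leaves T) \<le> Suc n \<and> set (leaves T) \<subseteq> {1..l}}
      \<subseteq> Leaf ` {1..l} \<union> (\<lambda>(x, L, R). Node x L R) ` (UNIV \<times> ?A \<times> ?A)" (is "?B \<subseteq> ?C")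
  proof
    fix T assume T: "T \<in> ?B"
    show "T \<in> ?C"
    proof (cases T)
      case (Leaf i)
      then show ?thesis using T by auto
    next
      case (Node x L R)
      then have "length (leaves L) + length (leaves R) \<le> Suc n"
        and "set (leaves L) \<subseteq> {1..l}" "set (leaves R) \<subseteq> {1..l}"
        using T by auto
      moreover from this(1) have "length (leaves L) \<le> n" "length (leaves R) \<le> n"
        using ne[of L] ne[of R] by linarith+
      ultimately have "L \<in> ?A" "R \<in> ?A" by blast+
      then have "(x, L, R) \<in> UNIV \<times> ?A \<times> ?A" by blast
      then show ?thesis unfolding Node by (intro UnI2 image_eqI[of _ _ "(x, L, R)"]) simp_all
    qed
  qed
  moreover have "finite ?C"
    by (intro finite_UnI finite_imageI finite_cartesian_product finite_UNIV Suc) simp_all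
  ultimately show ?case by (rule finite_subset)
qed

lemma finite_LT: "finite (LT l :: 'x::finite ltree set)"
proof (rule finite_subset[OF _ finite_ltree_bounded[of l l]])
  show "LT l \<subseteq> {T :: 'x ltree. length (leaves T) \<le> l \<and> set (leaves T) \<subseteq> {1..l}}"
  proof
    fix T :: "'x ltree" assume "T \<in> LT l"
    then have "distinct (leaves T)" and s: "set (leaves T) = {1..l}" by (auto simp: LT_def)
    then have "length (leaves T) = l" using distinct_card[of "leaves T"] by simp
    then show "T \<in> {T. length (leaves T) \<le> l \<and> set (leaves T) \<subseteq> {1..l}}" using s by simp
  qed
qed

instance colour :: finite
proof
  have "UNIV = {White, Black}" using colour.exhaust by auto
  then show "finite (UNIV :: colour set)" by (metis finite.simps)
qed

lemma equiv_Wilf_equivalent: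
  "equiv \<P> {(P, Q). P \<in> \<P> \<and> Q \<in> \<P> \<and> Wilf_equivalent P Q}"
  unfolding Wilf_equivalent_def
  by (intro equivI refl_onI symI transI subsetI) auto

end

theory Submission
  imports Defs "HOL-Library.Multiset" "HOL-Library.FuncSet"
begin

text \<open>A subtree with three leaves is a pair of adjacent internal vertices, so a set of patterns is a
  set \<open>E\<close> of kinds of edges. By a sign-reversing argument, cutting every tree below a top part with
  all edges in \<open>E\<close> such that the hanging trees have no edge in \<open>E\<close> shows that the numbers of trees
  with all edges in \<open>E\<close> and the numbers of trees avoiding \<open>E\<close> are inverse to each other (as for
  Koszul dual operads) and determine each other. Hence \<open>E\<close> and \<open>F\<close> are Wilf equivalent iff for
  every \<open>n\<close> there are as many trees with all edges in \<open>E\<close> as with all edges in \<open>F\<close>. For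
  \<open>|E| \<le> 2\<close> these numbers are small: \<open>2\<close>, \<open>n - 1\<close>, the involutions of \<open>n - 1\<close> points,
  \<open>(n - 1)!\<close>, or one of six sequences coming from a single set up to exchanging the colours.
  Their values at \<open>n = 4, 5, 6\<close> tell the ten sequences apart.\<close>

subsection \<open>Patterns as edges between internal vertices\<close>

text \<open>Avoiding at most two of the twelve edges leaves at least ten allowed, whereas trees
  built from at most two of them are nearly rigid; this is why the complement is counted. The two
  families determine each other because the inversion identity over a label set \<open>A\<close> is
  triangular in both directions: the top part that is a single leaf contributes the trees on
  \<open>A\<close> without edges in \<open>E\<close>, the top part that uses every label contributes
  the trees with all edges in \<open>E\<close>, and every other term involves only smaller values of
  the sequence being solved for. The obstacle in counting is that the kind of a left edge is not
  local: it compares the minimum of the child's right subtree with that of the parent's. Counts are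
  therefore refined by the colour of the root and the rank of its right minimum, which is all that a
  parent has to know. The six sequences without closed form only have to be told apart from the
  others, so three values of each suffice.\<close>

datatype kind = L12 | L13 | R23

type_synonym 'x edge = "kind \<times> 'x \<times> 'x"

fun pat :: "'x edge \<Rightarrow> 'x ltree" where
  "pat (L12, x, y) = Node x (Node y (Leaf 1) (Leaf 2)) (Leaf 3)"
| "pat (L13, x, y) = Node x (Node y (Leaf 1) (Leaf 3)) (Leaf 2)"
| "pat (R23, x, y) = Node x (Leaf 1) (Node y (Leaf 2) (Leaf 3))"

text \<open>The kind of a left edge depends on the right sibling only through its minimum, here the
  argument \<open>m\<close>. Cutting and grafting preserve minima, so edge kinds survive both
  operations.\<close>

fun ledge :: "'x \<Rightarrow> 'x ltree \<Rightarrow> nat \<Rightarrow> 'x edge set" where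
  "ledge x (Leaf i) m = {}"
| "ledge x (Node y L R) m = {(if assigned R < m then L12 else L13, x, y)}"

fun redge :: "'x \<Rightarrow> 'x ltree \<Rightarrow> 'x edge set" where
  "redge x (Leaf i) = {}"
| "redge x (Node y L R) = {(R23, x, y)}"

fun edges :: "'x ltree \<Rightarrow> 'x edge set" where
  "edges (Leaf i) = {}"
| "edges (Node x L R) = ledge x L (assigned R) \<union> redge x R \<union> edges L \<union> edges R"

lemma leaves_nonempty [simp]: "leaves T \<noteq> []"
  by (induction T) auto

lemma assigned_Leaf [simp]: "assigned (Leaf i) = i"
  by (simp add: assigned_def)

lemma assigned_Node [simp]: "assigned (Node x L R) = min (assigned L) (assigned R)"
  by (simp add: assigned_def Min_Un)

lemma assigned_in_leaves: "assigned T \<in> set (leaves T)"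
  by (simp add: assigned_def)

lemma inj_pat: "inj pat"
proof (rule injI)
  fix e f :: "'x edge"
  assume "pat e = pat f"
  then show "e = f" by (cases e rule: pat.cases; cases f rule: pat.cases) auto
qed

lemma length_leaves_1: "length (leaves T) = Suc 0 \<longleftrightarrow> (\<exists>i. T = Leaf i)"
  by (cases T) (auto simp: add_is_1)

lemma length_leaves_2:
  "length (leaves T) = 2 \<longleftrightarrow> (\<exists>x i j. T = Node x (Leaf i) (Leaf j))"
proof (cases T)
  case (Node x L R)
  have "length (leaves L) \<noteq> 0" "length (leaves R) \<noteq> 0" by simp_all
  then have "length (leaves T) = 2 \<longleftrightarrow> length (leaves L) = Suc 0 \<and> length (leaves R) = Suc 0"
    unfolding Node leaves.simps length_append by presburger
  then show ?thesis by (auto simp: Node length_leaves_1)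
qed auto

lemma length_leaves_3:
  "length (leaves T) = 3 \<longleftrightarrow>
    (\<exists>x y i j k. T = Node x (Node y (Leaf i) (Leaf j)) (Leaf k) \<or>
                 T = Node x (Leaf i) (Node y (Leaf j) (Leaf k)))"
proof (cases T)
  case (Node x L R)
  have "length (leaves L) \<noteq> 0" "length (leaves R) \<noteq> 0" by simp_all
  then have "length (leaves T) = 3 \<longleftrightarrow>
      length (leaves L) = 2 \<and> length (leaves R) = Suc 0 \<or>
      length (leaves L) = Suc 0 \<and> length (leaves R) = 2"
    unfolding Node leaves.simps length_append by presburger
  then show ?thesis by (auto simp: Node length_leaves_1 length_leaves_2)
qed auto

text \<open>Three leaves force one of two shapes. With the internal child on the left, 1 is the
  leftmost leaf and 2, 3 can be placed in two ways; with the child on the right the labelling is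
  forced.\<close>

lemma LT_3: "LT 3 = range pat"
proof -
  have i3: "{1..3::nat} = {1, 2, 3}" by auto
  show ?thesis
  proof (intro equalityI subsetI)
    fix T :: "'x ltree" assume "T \<in> LT 3"
    then have d: "distinct (leaves T)" and s: "set (leaves T) = {1..3}" and inc: "increasing T"
      by (auto simp: LT_def)
    have "length (leaves T) = 3" using distinct_card[OF d] s by simp
    then have "\<exists>x y i j k. T = Node x (Node y (Leaf i) (Leaf j)) (Leaf k) \<or>
                            T = Node x (Leaf i) (Node y (Leaf j) (Leaf k))"
      by (simp only: length_leaves_3)
    then obtain x y i j k where "T = Node x (Node y (Leaf i) (Leaf j)) (Leaf k) \<or>
        T = Node x (Leaf i) (Node y (Leaf j) (Leaf k))"
      by iprover
    then show "T \<in> range pat"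
    proof
      assume 1: "T = Node x (Node y (Leaf i) (Leaf j)) (Leaf k)"
      have "{i, j, k} = {1, 2, 3}" using s[unfolded i3] 1 by simp
      then have "i \<in> {1,2,3}" "j \<in> {1,2,3}" "k \<in> {1,2,3}" by blast+
      moreover have "i < j" "i < k" "j \<noteq> k" using inc d 1 by auto
      ultimately have "i = 1 \<and> j = 2 \<and> k = 3 \<or> i = 1 \<and> j = 3 \<and> k = 2" by auto
      then have "T = pat (L12, x, y) \<or> T = pat (L13, x, y)" using 1 by auto
      then show ?thesis by blast
    next
      assume 2: "T = Node x (Leaf i) (Node y (Leaf j) (Leaf k))"
      have "{i, j, k} = {1, 2, 3}" using s[unfolded i3] 2 by simp
      then have "i \<in> {1,2,3}" "j \<in> {1,2,3}" "k \<in> {1,2,3}" by blast+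
      moreover have "i < j" "j < k" using inc d 2 by auto
      ultimately have "i = 1 \<and> j = 2 \<and> k = 3" by auto
      then have "T = pat (R23, x, y)" using 2 by auto
      then show ?thesis by blast
    qed
  next
    fix T :: "'x ltree" assume "T \<in> range pat"
    then obtain e where "T = pat e" by blast
    then show "T \<in> LT 3"
      by (cases e rule: pat.cases) (simp_all add: LT_def i3[simplified] insert_commute)
  qed
qed

lemma Leaf_in_root_subtrees [simp]: "Leaf a \<in> root_subtrees T \<longleftrightarrow> a = assigned T"
  by (cases T) auto

lemma Node_in_root_subtrees:
  "Node x L' R' \<in> root_subtrees T \<longleftrightarrow>
    (\<exists>L R. T = Node x L R \<and> L' \<in> root_subtrees L \<and> R' \<in> root_subtrees R)"
  by (cases T) auto

lemma relabel_eq_Leaf: "relabel f T = Leaf i \<longleftrightarrow> (\<exists>j. T = Leaf j \<and> f j = i)"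
  by (cases T) auto

lemma relabel_eq_Node:
  "relabel f T = Node x L' R' \<longleftrightarrow>
    (\<exists>L R. T = Node x L R \<and> relabel f L = L' \<and> relabel f R = R')"
  by (cases T) auto

lemma rank_filter: "{j. (j = a \<or> j = b \<or> j = c) \<and> j \<le> i} =
    (if a \<le> i then {a} else {}) \<union> (if b \<le> i then {b} else {}) \<union> (if c \<le> i then {c} else {})"
  for i :: nat
  by auto

lemma st_left:
  assumes "a < b" "a < c" "b \<noteq> (c::nat)"
  shows "st (Node x (Node y (Leaf a) (Leaf b)) (Leaf c)) = pat (if b < c then L12 else L13, x, y)"
  using assms by (auto simp: st_def rank_filter card_insert_if numeral_eq_Suc)

lemma st_right:
  assumes "a < b" "b < (c::nat)"
  shows "st (Node x (Leaf a) (Node y (Leaf b) (Leaf c))) = pat (R23, x, y)"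
  using assms by (auto simp: st_def rank_filter card_insert_if numeral_eq_Suc)

text \<open>Relabelling keeps shapes, so only root subtrees consisting of the root and one internal
  child matter. Distinct leaves exclude a tie between the two minima that \<open>ledge\<close>
  compares.\<close>

lemma st_root_subtrees:
  assumes "distinct (leaves (Node x L R))" "increasing (Node x L R)"
  shows "(\<exists>S \<in> root_subtrees (Node x L R). st S = pat e) \<longleftrightarrow> e \<in> ledge x L (assigned R) \<union> redge x R"
proof
  assume "\<exists>S \<in> root_subtrees (Node x L R). st S = pat e"
  then obtain S where S: "S \<in> root_subtrees (Node x L R)" "st S = pat e" by blast
  then have "(\<exists>y z i j k. S = Node y (Node z (Leaf i) (Leaf j)) (Leaf k)) \<or>
             (\<exists>y z i j k. S = Node y (Leaf i) (Node z (Leaf j) (Leaf k)))"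
    by (cases e rule: pat.cases) (auto simp: st_def relabel_eq_Leaf relabel_eq_Node)
  then consider y z i j k where "S = Node y (Node z (Leaf i) (Leaf j)) (Leaf k)"
    | y z i j k where "S = Node y (Leaf i) (Node z (Leaf j) (Leaf k))" by blast
  then show "e \<in> ledge x L (assigned R) \<union> redge x R"
  proof cases
    case 1
    then obtain L1 L2 where L: "y = x" "L = Node z L1 L2" "i = assigned L1" "j = assigned L2" "k = assigned R"
      using S by (auto simp: Node_in_root_subtrees simp del: root_subtrees.simps)
    have "i < j" "i < k" using assms L by auto
    moreover have "j \<noteq> k" using assms(1) assigned_in_leaves[of L2] assigned_in_leaves[of R] L by auto
    ultimately have "e = (if j < k then L12 else L13, x, z)"
      using S(2) injD[OF inj_pat] st_left L(1) unfolding 1 by metis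
    then show ?thesis using L by auto
  next
    case 2
    then obtain R1 R2 where L: "y = x" "R = Node z R1 R2" "i = assigned L" "j = assigned R1" "k = assigned R2"
      using S by (auto simp: Node_in_root_subtrees simp del: root_subtrees.simps)
    have "i < j" "j < k" using assms L by auto
    then have "e = (R23, x, z)"
      using S(2) injD[OF inj_pat] st_right L(1) unfolding 2 by metis
    then show ?thesis using L by auto
  qed
next
  assume "e \<in> ledge x L (assigned R) \<union> redge x R"
  then consider "e \<in> ledge x L (assigned R)" | "e \<in> redge x R" by blast
  then show "\<exists>S \<in> root_subtrees (Node x L R). st S = pat e"
  proof cases
    case 1
    then obtain z L1 L2 where L: "L = Node z L1 L2" by (cases L) auto
    let ?S = "Node x (Node z (Leaf (assigned L1)) (Leaf (assigned L2))) (Leaf (assigned R))"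
    have "?S \<in> root_subtrees (Node x L R)" using L
      by (auto simp: Node_in_root_subtrees simp del: root_subtrees.simps)
    moreover have "st ?S = pat e"
    proof -
      have "assigned L1 < assigned L2" "assigned L1 < assigned R" using assms L by auto
      moreover have "assigned L2 \<noteq> assigned R"
        using assms(1) assigned_in_leaves[of L2] assigned_in_leaves[of R] L by auto
      ultimately show ?thesis using 1 L by (simp add: st_left)
    qed
    ultimately show ?thesis by blast
  next
    case 2
    then obtain z R1 R2 where L: "R = Node z R1 R2" by (cases R) auto
    let ?S = "Node x (Leaf (assigned L)) (Node z (Leaf (assigned R1)) (Leaf (assigned R2)))"
    have "?S \<in> root_subtrees (Node x L R)" using L
      by (auto simp: Node_in_root_subtrees simp del: root_subtrees.simps)
    moreover have "st ?S = pat e"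
    proof -
      have "assigned L < assigned R1" "assigned R1 < assigned R2" using assms L by auto
      then show ?thesis using 2 L by (simp add: st_right)
    qed
    ultimately show ?thesis by blast
  qed
qed

lemma st_subtrees_eq_edges:
  assumes "distinct (leaves T)" "increasing T"
  shows "(\<exists>S \<in> subtrees T. st S = pat e) \<longleftrightarrow> e \<in> edges T"
  using assms
proof (induction T)
  case (Node x L R)
  have "(\<exists>S \<in> subtrees (Node x L R). st S = pat e) \<longleftrightarrow>
      (\<exists>S \<in> root_subtrees (Node x L R). st S = pat e) \<or>
      (\<exists>S \<in> subtrees L. st S = pat e) \<or> (\<exists>S \<in> subtrees R. st S = pat e)"
    by (auto simp del: root_subtrees.simps)
  then show ?case using Node st_root_subtrees[OF Node.prems, of e] by (auto simp del: root_subtrees.simps)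
qed auto

lemma avoids_iff_edges:
  assumes "distinct (leaves T)" "increasing T"
  shows "avoids T (pat ` E) \<longleftrightarrow> edges T \<subseteq> - E"
  using st_subtrees_eq_edges[OF assms] unfolding avoids_def by blast

text \<open>Label sets are arbitrary because the pieces of a cut tree need not carry an initial
  segment of labels; \<open>card_trees\<close> shows that only the size of a finite \<open>A\<close>
  matters.\<close>

definition trees :: "nat set \<Rightarrow> 'x edge set \<Rightarrow> 'x ltree set" where
  "trees A E = {T. distinct (leaves T) \<and> set (leaves T) = A \<and> increasing T \<and> edges T \<subseteq> E}"

lemma LT_avoids: "{T \<in> LT l. avoids T (pat ` E)} = trees {1..l} (- E)"
  using avoids_iff_edges by (auto simp: LT_def trees_def)

subsection \<open>Inversion\<close>

text \<open>One multiset equation states both distinctness and the label set. It is additive when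
  trees are joined, which is what the treatment of grafting rests on.\<close>

lemma distinct_set_iff_mset:
  assumes "finite A"
  shows "distinct xs \<and> set xs = A \<longleftrightarrow> mset xs = mset_set A"
proof
  assume "distinct xs \<and> set xs = A"
  then show "mset xs = mset_set A" using mset_set_set[of xs] by simp
next
  assume eq: "mset xs = mset_set A"
  have "set xs = A" using arg_cong[OF eq, of set_mset] assms by simp
  moreover have "count (mset xs) a = (if a \<in> set xs then 1 else 0)" for a
    unfolding eq using assms \<open>set xs = A\<close> by simp
  then have "distinct xs" unfolding distinct_count_atmost_1 by simp
  ultimately show "distinct xs \<and> set xs = A" by blast
qed

lemma distinct_if_mset_subset:
  assumes "mset xs \<subseteq># mset_set A"
  shows "distinct xs"
proof -
  have "count (mset xs) a = (if a \<in> set xs then 1 else 0)" for a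
  proof (cases "a \<in> set xs")
    case True
    have "count (mset xs) a \<le> count (mset_set A) a" using assms by (rule mset_subset_eq_count)
    also have "\<dots> \<le> 1" by (simp add: count_mset_set')
    finally have "count (mset xs) a \<le> 1" .
    moreover have "count (mset xs) a > 0" using True by simp
    ultimately have "count (mset xs) a = 1" by linarith
    then show ?thesis using True by simp
  qed (simp add: count_eq_zero_iff)
  then show ?thesis unfolding distinct_count_atmost_1 by simp
qed

lemma trees_mset:
  "finite A \<Longrightarrow> T \<in> trees A E \<longleftrightarrow> mset (leaves T) = mset_set A \<and> increasing T \<and> edges T \<subseteq> E"
  using distinct_set_iff_mset[of A "leaves T"] by (auto simp: trees_def)

lemma finite_trees [simp]:
  assumes "finite A"
  shows "finite (trees A E :: 'x::finite ltree set)"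
proof -
  obtain l where l: "A \<subseteq> {0..l}" using assms by (auto simp: finite_nat_set_iff_bounded_le subset_eq)
  \<comment> \<open>The bound \<open>finite_ltree_bounded\<close> admits only positive labels, while
    \<open>A\<close> may contain 0; hence the shift by \<open>Suc\<close>.\<close>
  have shift: "inj (relabel Suc :: 'x ltree \<Rightarrow> 'x ltree)"
  proof (rule injI)
    fix S T :: "'x ltree"
    assume "relabel Suc S = relabel Suc T"
    then show "S = T"
    proof (induction S arbitrary: T)
      case (Leaf i) then show ?case by (cases T) auto
    next
      case (Node x L R) then show ?case by (cases T) auto
    qed
  qed
  have leaves_shift: "leaves (relabel Suc T) = map Suc (leaves T)" for T :: "'x ltree"
    by (induction T) auto
  have "relabel Suc ` (trees A E :: 'x ltree set)
      \<subseteq> {T. length (leaves T) \<le> card A \<and> set (leaves T) \<subseteq> {1..Suc l}}"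
    using l by (auto simp: trees_def leaves_shift distinct_card subset_eq)
  then have "finite (relabel Suc ` (trees A E :: 'x ltree set))"
    using finite_ltree_bounded finite_subset by blast
  then show ?thesis using finite_imageD shift inj_on_subset by blast
qed

text \<open>A member is a top part of the tree: some subtrees are collapsed to their minima, all
  edges kept lie in \<open>E\<close>, and the collapsed subtrees have no edge in \<open>E\<close>.
  The edge leading to a collapsed subtree is unconstrained, since \<open>ledge\<close> and
  \<open>redge\<close> of a leaf are empty.\<close>

fun cuts :: "'x edge set \<Rightarrow> 'x ltree \<Rightarrow> 'x ltree set" where
  "cuts E (Leaf i) = {Leaf i}"
| "cuts E (Node x L R) =
     (if edges (Node x L R) \<subseteq> - E then {Leaf (assigned (Node x L R))} else {}) \<union>
     (\<lambda>(L', R'). Node x L' R') ` {(L', R'). L' \<in> cuts E L \<and> R' \<in> cuts E R \<and>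
        ledge x L' (assigned R) \<subseteq> E \<and> redge x R' \<subseteq> E}"

lemma finite_cuts [simp]: "finite (cuts E T)"
proof (induction T)
  case (Node x L R)
  then have "finite (cuts E L \<times> cuts E R)" by simp
  then have "finite {(L', R'). L' \<in> cuts E L \<and> R' \<in> cuts E R \<and>
        ledge x L' (assigned R) \<subseteq> E \<and> redge x R' \<subseteq> E}"
    by (rule rev_finite_subset) auto
  then show ?case by simp
qed auto

lemma assigned_cuts: "S \<in> cuts E T \<Longrightarrow> assigned S = assigned T"
  by (induction T arbitrary: S) (auto split: if_splits)

lemma Leaf_in_cuts: "Leaf i \<in> cuts E T \<longleftrightarrow> i = assigned T \<and> edges T \<subseteq> - E"
  by (cases T) (auto split: if_splits)

lemma Node_in_cuts: "Node x L' R' \<in> cuts E T \<longleftrightarrow>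
  (\<exists>L R. T = Node x L R \<and> L' \<in> cuts E L \<and> R' \<in> cuts E R \<and>
     ledge x L' (assigned R) \<subseteq> E \<and> redge x R' \<subseteq> E)"
  by (cases T) (auto split: if_splits)

text \<open>This sign is multiplicative under \<open>Node\<close>, so signed sums over cuts factor
  over the two subtrees of the root.\<close>

definition sgn_leaves :: "'x ltree \<Rightarrow> int" where
  "sgn_leaves S = (- 1) ^ length (leaves S)"

text \<open>The hypothesis is the induction hypothesis of the cancellation in \<open>sum_cuts\<close>. All cuts of
  \<open>L\<close> other than the single leaf use the edge above \<open>L\<close>, so the terms cancel if that edge is in
  \<open>E\<close>, and otherwise only the leaf can remain.\<close>

lemma sum_ledge_cuts:
  assumes "(\<exists>i. L = Leaf i) \<or> (\<Sum>S \<in> cuts E L. sgn_leaves S) = 0"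
  shows "(\<Sum>S \<in> {S \<in> cuts E L. ledge x S m \<subseteq> E}. sgn_leaves S) =
         (if edges L \<union> ledge x L m \<subseteq> - E then - 1 else 0)"
proof (cases L)
  case (Leaf i)
  then have "{S \<in> cuts E L. ledge x S m \<subseteq> E} = {Leaf i}" by auto
  then show ?thesis using Leaf by (simp add: sgn_leaves_def)
next
  case (Node y L1 L2)
  let ?e = "(if assigned L2 < m then L12 else L13, x, y)"
  \<comment> \<open>A cut other than the single leaf keeps the root of \<open>L\<close> and the
    minimum of its right subtree, hence also the kind of the edge to the parent.\<close>
  have e: "ledge x S m = {?e}" if "S \<in> cuts E L" "S \<noteq> Leaf (assigned L)" for S
    using that unfolding Node by (auto simp: assigned_cuts split: if_splits)
  show ?thesis
  proof (cases "?e \<in> E")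
    case True
    then have "{S \<in> cuts E L. ledge x S m \<subseteq> E} = cuts E L"
      using e by (metis (no_types, lifting) Collect_cong Collect_mem_eq empty_subsetI
        insert_subset ledge.simps(1))
    then show ?thesis using assms Node True by simp
  next
    case False
    then have "{S \<in> cuts E L. ledge x S m \<subseteq> E} = {S \<in> cuts E L. S = Leaf (assigned L)}"
      using e by fastforce
    also have "\<dots> = (if edges L \<subseteq> - E then {Leaf (assigned L)} else {})"
      by (auto simp: Leaf_in_cuts)
    finally show ?thesis using Node False by (simp add: sgn_leaves_def)
  qed
qed

lemma sum_redge_cuts:
  assumes "(\<exists>i. R = Leaf i) \<or> (\<Sum>S \<in> cuts E R. sgn_leaves S) = 0"
  shows "(\<Sum>S \<in> {S \<in> cuts E R. redge x S \<subseteq> E}. sgn_leaves S) =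
         (if edges R \<union> redge x R \<subseteq> - E then - 1 else 0)"
proof (cases R)
  case (Leaf i)
  then have "{S \<in> cuts E R. redge x S \<subseteq> E} = {Leaf i}" by auto
  then show ?thesis using Leaf by (simp add: sgn_leaves_def)
next
  case (Node y R1 R2)
  let ?e = "(R23, x, y)"
  have e: "redge x S = {?e}" if "S \<in> cuts E R" "S \<noteq> Leaf (assigned R)" for S
    using that unfolding Node by (auto split: if_splits)
  show ?thesis
  proof (cases "?e \<in> E")
    case True
    then have "{S \<in> cuts E R. redge x S \<subseteq> E} = cuts E R"
      using e by (metis (no_types, lifting) Collect_cong Collect_mem_eq empty_subsetI
        insert_subset redge.simps(1))
    then show ?thesis using assms Node True by simp
  next
    case False
    then have "{S \<in> cuts E R. redge x S \<subseteq> E} = {S \<in> cuts E R. S = Leaf (assigned R)}"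
      using e by fastforce
    also have "\<dots> = (if edges R \<subseteq> - E then {Leaf (assigned R)} else {})"
      by (auto simp: Leaf_in_cuts)
    finally show ?thesis using Node False by (simp add: sgn_leaves_def)
  qed
qed

text \<open>The cuts that keep the root contribute the product of two one-sided sums, each -1 or 0.
  The product is 1 exactly if no edge of \<open>T\<close> lies in \<open>E\<close>, which is exactly
  when the single-leaf cut, of sign -1, is available. A leaf has only itself as a cut, hence the
  exception.\<close>

lemma sum_cuts:
  fixes T :: "'x ltree"
  shows "(\<exists>i. T = Leaf i) \<or> (\<Sum>S \<in> cuts E T. sgn_leaves S) = 0"
proof (induction T)
  case (Node x L R)
  let ?N = "\<lambda>(L', R'). Node x L' R'"
  let ?l = "{S \<in> cuts E L. ledge x S (assigned R) \<subseteq> E}" and ?r = "{S \<in> cuts E R. redge x S \<subseteq> E}"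
  let ?leaf = "if edges (Node x L R) \<subseteq> - E then {Leaf (assigned (Node x L R)) :: 'x ltree} else {}"
  have fin: "finite (?l \<times> ?r)" by (intro finite_cartesian_product) simp_all
  have "cuts E (Node x L R) = ?leaf \<union> ?N ` (?l \<times> ?r)" by auto
  then have "(\<Sum>S \<in> cuts E (Node x L R). sgn_leaves S) = (\<Sum>S \<in> ?leaf \<union> ?N ` (?l \<times> ?r). sgn_leaves S)"
    by (rule arg_cong)
  also have "\<dots> =
      (\<Sum>S \<in> ?leaf. sgn_leaves S) + (\<Sum>S \<in> ?N ` (?l \<times> ?r). sgn_leaves S)"
    by (intro sum.union_disjoint finite_imageI) (use fin in auto)
  also have "(\<Sum>S \<in> ?N ` (?l \<times> ?r). sgn_leaves S) = (\<Sum>(L', R') \<in> ?l \<times> ?r. sgn_leaves L' * sgn_leaves R')"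
    by (subst sum.reindex) (auto simp: inj_on_def sgn_leaves_def power_add intro!: sum.cong)
  also have "\<dots> = (\<Sum>S \<in> ?l. sgn_leaves S) * (\<Sum>S \<in> ?r. sgn_leaves S)"
    by (simp only: sum_product sum.cartesian_product)
  also have "\<dots> = (if edges (Node x L R) \<subseteq> - E then 1 else 0)"
    by (subst sum_ledge_cuts[OF Node.IH(1)], subst sum_redge_cuts[OF Node.IH(2)]) auto
  also have "(\<Sum>S \<in> ?leaf. sgn_leaves S) = - (if edges (Node x L R) \<subseteq> - E then 1 else 0)"
    by (simp add: sgn_leaves_def)
  finally show ?case by simp
qed auto

section \<open>Grafting, the inverse of cutting\<close>

fun graft :: "'x ltree \<Rightarrow> (nat \<Rightarrow> 'x ltree) \<Rightarrow> 'x ltree" where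
  "graft (Leaf i) h = h i"
| "graft (Node x L R) h = Node x (graft L h) (graft R h)"

lemma graft_cong: "(\<And>i. i \<in> set (leaves S) \<Longrightarrow> h i = h' i) \<Longrightarrow> graft S h = graft S h'"
  by (induction S) auto

lemma graft_inj: "graft S h = graft S h' \<Longrightarrow> i \<in> set (leaves S) \<Longrightarrow> h i = h' i"
  by (induction S) auto

lemma mset_leaves_graft:
  "mset (leaves (graft S h)) = (\<Sum>i \<in># mset (leaves S). mset (leaves (h i)))"
  by (induction S) auto

lemma assigned_graft:
  "(\<And>i. i \<in> set (leaves S) \<Longrightarrow> assigned (h i) = i) \<Longrightarrow> assigned (graft S h) = assigned S"
  by (induction S) auto

lemma increasing_graft:
  assumes "\<And>i. i \<in> set (leaves S) \<Longrightarrow> assigned (h i) = i"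
  shows "increasing (graft S h) \<longleftrightarrow> increasing S \<and> (\<forall>i \<in> set (leaves S). increasing (h i))"
  using assms by (induction S) (auto simp: assigned_graft)

lemma graft_in_cuts:
  assumes "edges S \<subseteq> E" "\<And>i. i \<in> set (leaves S) \<Longrightarrow> assigned (h i) = i \<and> edges (h i) \<subseteq> - E"
  shows "S \<in> cuts E (graft S h)"
  using assms
proof (induction S)
  case (Leaf i)
  then show ?case by (simp add: Leaf_in_cuts)
next
  case (Node x L R)
  then have "L \<in> cuts E (graft L h)" "R \<in> cuts E (graft R h)" by auto
  moreover have "assigned (graft R h) = assigned R" using Node.prems by (auto intro: assigned_graft)
  ultimately show ?case using Node.prems(1) by (simp add: Node_in_cuts del: cuts.simps)
qed

lemma cuts_leaves: "S \<in> cuts E T \<Longrightarrow> mset (leaves S) \<subseteq># mset (leaves T)"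
proof (induction S arbitrary: T)
  case (Leaf i)
  then show ?case using assigned_in_leaves[of T] by (simp add: Leaf_in_cuts)
next
  case (Node x L R)
  then show ?case by (auto simp: Node_in_cuts intro!: subset_mset.add_mono)
qed

lemma cuts_edges: "S \<in> cuts E T \<Longrightarrow> edges S \<subseteq> E"
proof (induction S arbitrary: T)
  case (Node x L R)
  then obtain L' R' where T: "T = Node x L' R'" "L \<in> cuts E L'" "R \<in> cuts E R'"
     "ledge x L (assigned R') \<subseteq> E" "redge x R \<subseteq> E"
    by (auto simp: Node_in_cuts)
  then show ?case using Node.IH assigned_cuts[OF T(3)] by auto
qed auto

text \<open>Converse of \<open>graft_in_cuts\<close>: the subtree of \<open>T\<close> at the place
  of the leaf \<open>i\<close> of \<open>S\<close> serves as \<open>h i\<close>.\<close>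

lemma cuts_graft:
  assumes "S \<in> cuts E T" "distinct (leaves S)"
  shows "\<exists>h. T = graft S h \<and> (\<forall>i \<in> set (leaves S). assigned (h i) = i \<and> edges (h i) \<subseteq> - E)"
  using assms
proof (induction S arbitrary: T)
  case (Leaf i)
  then show ?case by (intro exI[of _ "\<lambda>_. T"]) (simp add: Leaf_in_cuts)
next
  case (Node x L R)
  then obtain L' R' where T: "T = Node x L' R'" "L \<in> cuts E L'" "R \<in> cuts E R'"
    by (auto simp: Node_in_cuts)
  obtain g where g: "L' = graft L g" "\<And>i. i \<in> set (leaves L) \<Longrightarrow> assigned (g i) = i \<and> edges (g i) \<subseteq> - E"
    using Node.IH(1)[OF T(2)] Node.prems(2) by auto
  obtain h where h: "R' = graft R h" "\<And>i. i \<in> set (leaves R) \<Longrightarrow> assigned (h i) = i \<and> edges (h i) \<subseteq> - E"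
    using Node.IH(2)[OF T(3)] Node.prems(2) by auto
  \<comment> \<open>The leaves of \<open>S\<close> are distinct, so the label sets of
    \<open>L\<close> and \<open>R\<close> are disjoint and both functions fit into one.\<close>
  let ?k = "\<lambda>i. if i \<in> set (leaves L) then g i else h i"
  have "graft L ?k = graft L g" by (rule graft_cong) simp
  moreover have "graft R ?k = graft R h" using Node.prems(2) by (intro graft_cong) auto
  ultimately show ?case using T(1) g h by (intro exI[of _ ?k]) auto
qed

text \<open>The hanging trees, indexed by the leaves of the top part. The sum of multisets makes
  their leaf sets partition \<open>A\<close>; extensionality on \<open>M\<close> makes
  \<open>graft S\<close> injective.\<close>

definition forests :: "nat set \<Rightarrow> nat set \<Rightarrow> 'x edge set \<Rightarrow> (nat \<Rightarrow> 'x ltree) set" where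
  "forests M A E = {h \<in> M \<rightarrow>\<^sub>E UNIV. (\<Sum>i\<in>M. mset (leaves (h i))) = mset_set A \<and>
     (\<forall>i\<in>M. assigned (h i) = i \<and> increasing (h i) \<and> edges (h i) \<subseteq> E)}"

lemma trees_with_cut:
  assumes "finite A" "finite M" "S \<in> trees M E"
  shows "{T \<in> trees A UNIV. S \<in> cuts E T} = graft S ` forests M A (- E)"
    and "inj_on (graft S) (forests M A (- E))"
proof -
  have S: "set (leaves S) = M" "distinct (leaves S)" "increasing S" "edges S \<subseteq> E"
    "mset (leaves S) = mset_set M"
    using assms(2,3) trees_mset[OF assms(2), of S E] by (auto simp: trees_def)
  have leaves_eq: "mset (leaves (graft S h)) = (\<Sum>i\<in>M. mset (leaves (h i)))" for h
    using mset_leaves_graft[of S h] by (simp add: S(5) sum_unfold_sum_mset)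
  show "{T \<in> trees A UNIV. S \<in> cuts E T} = graft S ` forests M A (- E)"
  proof (intro equalityI subsetI)
    fix T assume "T \<in> {T \<in> trees A UNIV. S \<in> cuts E T}"
    then have T: "mset (leaves T) = mset_set A" "increasing T" "S \<in> cuts E T"
      using trees_mset[OF assms(1), of T UNIV] by auto
    obtain h where h: "T = graft S h" "\<And>i. i \<in> M \<Longrightarrow> assigned (h i) = i \<and> edges (h i) \<subseteq> - E"
      using cuts_graft[OF T(3) S(2)] S(1) by auto
    have "graft S (restrict h M) = T" unfolding h(1) using S(1) by (intro graft_cong) auto
    moreover have "restrict h M \<in> forests M A (- E)"
      using T(1,2) h leaves_eq[of h] increasing_graft[of S h] S(1)
      by (auto simp: forests_def)
    ultimately show "T \<in> graft S ` forests M A (- E)" by blast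
  next
    fix T assume "T \<in> graft S ` forests M A (- E)"
    then obtain h where h: "h \<in> forests M A (- E)" "T = graft S h" by blast
    then have "S \<in> cuts E T" using graft_in_cuts[of S E h] S by (auto simp: forests_def)
    moreover have "T \<in> trees A UNIV"
      unfolding trees_mset[OF assms(1)] h(2) leaves_eq using h(1) S increasing_graft[of S h]
      by (auto simp: forests_def)
    ultimately show "T \<in> {T \<in> trees A UNIV. S \<in> cuts E T}" by blast
  qed
  show "inj_on (graft S) (forests M A (- E))"
  proof (rule inj_onI)
    fix g h assume gh: "g \<in> forests M A (- E)" "h \<in> forests M A (- E)" "graft S g = graft S h"
    show "g = h"
    proof (rule PiE_ext)
      show "g \<in> M \<rightarrow>\<^sub>E UNIV" "h \<in> M \<rightarrow>\<^sub>E UNIV" using gh by (auto simp: forests_def)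
      show "g i = h i" if "i \<in> M" for i using graft_inj[OF gh(3)] that S(1) by auto
    qed
  qed
qed

text \<open>Set partitions of \<open>A\<close> with \<open>M\<close> as the set of block minima,
  written as functions from the minimum to the block. Disjointness is again part of a multiset
  equation.\<close>

definition blocks :: "nat set \<Rightarrow> nat set \<Rightarrow> (nat \<Rightarrow> nat set) set" where
  "blocks M A = {B \<in> M \<rightarrow>\<^sub>E Pow A. (\<Sum>i\<in>M. mset_set (B i)) = mset_set A \<and>
     (\<forall>i\<in>M. B i \<noteq> {} \<and> Min (B i) = i)}"

lemma finite_blocks: "finite A \<Longrightarrow> finite M \<Longrightarrow> finite (blocks M A)"
  by (rule finite_subset[of _ "M \<rightarrow>\<^sub>E Pow A"]) (auto simp: blocks_def intro: finite_PiE)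

text \<open>A forest determines its blocks as the leaf sets of its trees; given the blocks, the
  trees are chosen independently.\<close>

lemma card_forests:
  assumes "finite A" "finite M"
  shows "card (forests M A E :: (nat \<Rightarrow> 'x::finite ltree) set) =
    (\<Sum>B \<in> blocks M A. \<Prod>i\<in>M. card (trees (B i) E :: 'x ltree set))"
proof -
  have sub: "B i \<subseteq> A" "finite (B i)" if "B \<in> blocks M A" "i \<in> M" for B i
    using that assms by (auto simp: blocks_def PiE_def Pi_def intro: finite_subset)
  have "forests M A E = (\<Union>B \<in> blocks M A. PiE M (\<lambda>i. trees (B i) E :: 'x ltree set))"
  proof (intro equalityI subsetI)
    fix h :: "nat \<Rightarrow> 'x ltree" assume h: "h \<in> forests M A E"
    let ?B = "\<lambda>i\<in>M. set (leaves (h i))"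
    have eq: "(\<Sum>i\<in>M. mset (leaves (h i))) = mset_set A" using h by (simp add: forests_def)
    have le: "mset (leaves (h i)) \<subseteq># mset_set A" if "i \<in> M" for i
      using that assms(2) unfolding eq[symmetric] by (simp add: sum.remove)
    have d: "distinct (leaves (h i))" if "i \<in> M" for i
      using le[OF that] by (rule distinct_if_mset_subset)
    have "set (leaves (h i)) \<subseteq> A" if "i \<in> M" for i
      using set_mset_mono[OF le[OF that]] assms(1) by simp
    moreover have "(\<Sum>i\<in>M. mset_set (?B i)) = (\<Sum>i\<in>M. mset (leaves (h i)))"
      using d by (intro sum.cong) (simp_all add: mset_set_set)
    ultimately have "?B \<in> blocks M A"
      using h eq by (auto simp: blocks_def forests_def assigned_def)
    moreover have "h \<in> PiE M (\<lambda>i. trees (?B i) E)"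
      using h d by (auto simp: forests_def trees_def PiE_def)
    ultimately show "h \<in> (\<Union>B \<in> blocks M A. PiE M (\<lambda>i. trees (B i) E))" by blast
  next
    fix h :: "nat \<Rightarrow> 'x ltree"
    assume "h \<in> (\<Union>B \<in> blocks M A. PiE M (\<lambda>i. trees (B i) E))"
    then obtain B where B: "B \<in> blocks M A" "h \<in> PiE M (\<lambda>i. trees (B i) E)" by blast
    have t: "h i \<in> trees (B i) E" if "i \<in> M" for i using B(2) that by auto
    have "mset (leaves (h i)) = mset_set (B i)" if "i \<in> M" for i
      using t[OF that] trees_mset sub[OF B(1) that] by blast
    then have "(\<Sum>i\<in>M. mset (leaves (h i))) = mset_set A"
      using B(1) by (simp add: blocks_def)
    then show "h \<in> forests M A E"
      using t B by (auto simp: forests_def trees_def assigned_def blocks_def PiE_def)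
  qed
  moreover have "card (\<Union>B \<in> blocks M A. PiE M (\<lambda>i. trees (B i) E :: 'x ltree set)) =
      (\<Sum>B \<in> blocks M A. card (PiE M (\<lambda>i. trees (B i) E :: 'x ltree set)))"
  proof (rule card_UN_disjoint)
    show "finite (blocks M A)" by (rule finite_blocks[OF assms])
    show "\<forall>B\<in>blocks M A. finite (PiE M (\<lambda>i. trees (B i) E :: 'x ltree set))"
      using assms(2) sub by (auto intro!: finite_PiE)
    show "\<forall>B\<in>blocks M A. \<forall>C\<in>blocks M A. B \<noteq> C \<longrightarrow>
        PiE M (\<lambda>i. trees (B i) E :: 'x ltree set) \<inter> PiE M (\<lambda>i. trees (C i) E) = {}"
    proof (intro ballI impI)
      fix B C assume BC: "B \<in> blocks M A" "C \<in> blocks M A" "B \<noteq> C"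
      then obtain i where i: "i \<in> M" "B i \<noteq> C i"
        by (metis (no_types, lifting) PiE_ext blocks_def mem_Collect_eq)
      have "trees (B i) E \<inter> (trees (C i) E :: 'x ltree set) = {}" using i(2) by (auto simp: trees_def)
      then show "PiE M (\<lambda>i. trees (B i) E :: 'x ltree set) \<inter> PiE M (\<lambda>i. trees (C i) E) = {}"
        using i(1) by (auto simp: PiE_def Pi_def)
    qed
  qed
  ultimately show ?thesis using assms(2) by (simp add: card_PiE)
qed

text \<open>Double counting of pairs of a tree \<open>T\<close> on \<open>A\<close> and a cut
  \<open>S\<close> of \<open>T\<close>, with the sign of \<open>S\<close>. For fixed
  \<open>T\<close> the sum vanishes by \<open>sum_cuts\<close>, as two labels rule out a leaf; for
  fixed \<open>S\<close> with label set \<open>M\<close> the trees \<open>T\<close> correspond to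
  forests.\<close>

theorem inversion:
  fixes E :: "'x::finite edge set"
  assumes "finite A" "card A \<ge> 2"
  shows "(\<Sum>M \<in> Pow A. (- 1) ^ card M * int (card (trees M E)) *
           (\<Sum>B \<in> blocks M A. \<Prod>i\<in>M. int (card (trees (B i) (- E))))) = 0"
proof -
  have fin: "finite M" if "M \<in> Pow A" for M using that assms(1) finite_subset by auto
  have "(\<Sum>S \<in> cuts E T. sgn_leaves S) =
      (\<Sum>M \<in> Pow A. \<Sum>S \<in> trees M E. if S \<in> cuts E T then sgn_leaves S else 0)"
    if T: "T \<in> trees A UNIV" for T
  proof -
    have "cuts E T \<subseteq> (\<Union>M \<in> Pow A. trees M E)"
    proof
      fix S assume S: "S \<in> cuts E T"
      have le: "mset (leaves S) \<subseteq># mset (leaves T)" by (rule cuts_leaves[OF S])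
      have TA: "distinct (leaves T)" "set (leaves T) = A" "increasing T" using T by (auto simp: trees_def)
      have sub: "set (leaves S) \<subseteq> A" using set_mset_mono[OF le] TA by simp
      have d: "distinct (leaves S)"
        using le TA(1) distinct_if_mset_subset[of "leaves S" "set (leaves T)"] by (simp add: mset_set_set)
      obtain h where h: "T = graft S h" "\<forall>i \<in> set (leaves S). assigned (h i) = i \<and> edges (h i) \<subseteq> - E"
        using cuts_graft[OF S d] by blast
      then have "increasing S" using TA(3) increasing_graft[of S h] by auto
      then have "S \<in> trees (set (leaves S)) E" using d cuts_edges[OF S] by (simp add: trees_def)
      then show "S \<in> (\<Union>M \<in> Pow A. trees M E)" using sub by blast
    qed
    then have "(\<Sum>S \<in> cuts E T. sgn_leaves S) =
        (\<Sum>S \<in> (\<Union>M \<in> Pow A. trees M E) \<inter> cuts E T. sgn_leaves S)"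
      by (simp add: Int_absorb1)
    also have "\<dots> = (\<Sum>S \<in> (\<Union>M \<in> Pow A. trees M E). if S \<in> cuts E T then sgn_leaves S else 0)"
      using assms(1) fin by (intro sum.inter_restrict) auto
    also have "\<dots> = (\<Sum>M \<in> Pow A. \<Sum>S \<in> trees M E. if S \<in> cuts E T then sgn_leaves S else 0)"
    proof (intro sum.UNION_disjoint ballI impI)
      show "finite (trees M E :: 'x ltree set)" if "M \<in> Pow A" for M using fin[OF that] by simp
    qed (use assms(1) in \<open>auto simp: trees_def\<close>)
    finally show ?thesis .
  qed
  moreover have "(\<Sum>S \<in> cuts E T. sgn_leaves S) = 0" if T: "T \<in> trees A UNIV" for T
  proof -
    have "\<not> (\<exists>i. T = Leaf i)" using T assms(2) by (auto simp: trees_def)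
    then show ?thesis using sum_cuts[of T E] by blast
  qed
  ultimately have "0 = (\<Sum>T \<in> trees A UNIV. \<Sum>M \<in> Pow A. \<Sum>S \<in> trees M E.
      if S \<in> cuts E T then sgn_leaves S else 0)" by simp
  also have "\<dots> = (\<Sum>M \<in> Pow A. \<Sum>S \<in> trees M E. \<Sum>T \<in> trees A UNIV.
      if S \<in> cuts E T then sgn_leaves S else 0)"
    by (subst sum.swap, rule sum.cong[OF refl], subst sum.swap, rule refl)
  also have "\<dots> = (\<Sum>M \<in> Pow A. \<Sum>S \<in> trees M E. (- 1) ^ card M *
      (\<Sum>B \<in> blocks M A. \<Prod>i\<in>M. int (card (trees (B i) (- E) :: 'x ltree set))))"
  proof (intro sum.cong refl)
    fix M S assume M: "M \<in> Pow A" and S: "S \<in> trees M E"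
    have "(\<Sum>T \<in> trees A UNIV. if S \<in> cuts E T then sgn_leaves S else 0) =
        (\<Sum>T \<in> {T \<in> trees A UNIV. S \<in> cuts E T}. sgn_leaves S)"
      using assms(1) by (intro sum.inter_filter[symmetric]) simp
    also have "\<dots> = sgn_leaves S * int (card (forests M A (- E) :: (nat \<Rightarrow> 'x ltree) set))"
      using trees_with_cut[OF assms(1) fin[OF M] S] by (simp add: card_image)
    also have "\<dots> = (- 1) ^ card M * int (card (forests M A (- E) :: (nat \<Rightarrow> 'x ltree) set))"
      using S by (auto simp: sgn_leaves_def trees_def distinct_card)
    finally show "(\<Sum>T \<in> trees A UNIV. if S \<in> cuts E T then sgn_leaves S else 0) =
        (- 1) ^ card M * (\<Sum>B \<in> blocks M A. \<Prod>i\<in>M. int (card (trees (B i) (- E) :: 'x ltree set)))"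
      by (simp add: card_forests[OF assms(1) fin[OF M]])
  qed
  also have "\<dots> = (\<Sum>M \<in> Pow A. (- 1) ^ card M * int (card (trees M E)) *
           (\<Sum>B \<in> blocks M A. \<Prod>i\<in>M. int (card (trees (B i) (- E)))))"
    by (intro sum.cong refl) simp
  finally show ?thesis by simp
qed

section \<open>Triangularity of the inversion identity\<close>

lemma card_blocks:
  assumes "B \<in> blocks M A"
  shows "(\<Sum>i\<in>M. card (B i)) = card A"
proof -
  have "(\<Sum>i\<in>M. card (B i)) = size (\<Sum>i\<in>M. mset_set (B i))"
    by (induction M rule: infinite_finite_induct) auto
  also have "(\<Sum>i\<in>M. mset_set (B i)) = mset_set A"
    using assms by (simp only: blocks_def mem_Collect_eq)
  finally show ?thesis by simp
qed

lemma blocks_subset: "B \<in> blocks M A \<Longrightarrow> i \<in> M \<Longrightarrow> B i \<subseteq> A \<and> B i \<noteq> {} \<and> Min (B i) = i"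
  by (auto simp: blocks_def)

text \<open>A block equal to \<open>A\<close> leaves nothing for the others, which are nonempty; so
  it is the only block, and \<open>M\<close> consists of the minimum of \<open>A\<close>.\<close>

lemma card_block_less:
  assumes "finite A" "M \<subseteq> A" "M \<noteq> {Min A}" "B \<in> blocks M A" "i \<in> M"
  shows "card (B i) < card A"
proof (rule ccontr)
  assume "\<not> card (B i) < card A"
  then have Bi: "B i = A"
    using blocks_subset[OF assms(4,5)] assms(1) by (meson card_subset_eq card_mono leI le_antisym)
  have finM: "finite M" using assms(1,2) finite_subset by blast
  have "card A = card (B i) + (\<Sum>k\<in>M - {i}. card (B k))"
    using card_blocks[OF assms(4)] sum.remove[OF finM assms(5), of "\<lambda>k. card (B k)"] by simp
  then have "(\<Sum>k\<in>M - {i}. card (B k)) = 0" using Bi by simp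
  then have "\<forall>k\<in>M - {i}. card (B k) = 0" using finM by simp
  moreover have "card (B k) \<noteq> 0" if "k \<in> M" for k
  proof -
    have "finite (B k)" "B k \<noteq> {}"
      using blocks_subset[OF assms(4) that] assms(1) finite_subset[of "B k" A] by simp_all
    then show ?thesis by simp
  qed
  ultimately have "M - {i} = {}" by blast
  then have "M = {i}" using assms(5) by blast
  moreover have "i = Min A" using blocks_subset[OF assms(4,5)] Bi by simp
  ultimately show False using assms(3) by simp
qed

lemma blocks_Min:
  assumes "finite A" "A \<noteq> {}"
  shows "blocks {Min A} A = {\<lambda>i\<in>{Min A}. A}"
proof (intro equalityI subsetI)
  fix B assume B: "B \<in> blocks {Min A} A"
  have "B (Min A) \<subseteq> A" using blocks_subset[OF B] by simp
  moreover have "card (B (Min A)) = card A" using card_blocks[OF B] by simp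
  ultimately have "B (Min A) = A" using assms(1) card_subset_eq by blast
  moreover have "B \<in> {Min A} \<rightarrow>\<^sub>E Pow A" using B by (simp add: blocks_def)
  ultimately show "B \<in> {\<lambda>i\<in>{Min A}. A}" by (auto simp: PiE_def extensional_def fun_eq_iff)
qed (use assms in \<open>auto simp: blocks_def\<close>)

lemma singleton_blocks:
  assumes "finite A"
  shows "(\<lambda>i\<in>A. {i}) \<in> blocks A A"
proof -
  have "(\<Sum>i\<in>A. mset_set {i}) = mset_set A"
    using assms by (induction A rule: finite_induct) auto
  then show ?thesis by (auto simp: blocks_def)
qed

text \<open>The summand of \<open>inversion\<close> in terms of sizes alone: \<open>p\<close> counts
  top parts, \<open>a\<close> counts hanging trees.\<close>

definition conv :: "(nat \<Rightarrow> int) \<Rightarrow> (nat \<Rightarrow> int) \<Rightarrow> nat set \<Rightarrow> nat set \<Rightarrow> int" where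
  "conv p a A M = (- 1) ^ card M * p (card M) * (\<Sum>B \<in> blocks M A. \<Prod>i\<in>M. a (card (B i)))"

text \<open>Strong induction on the size, isolating one extreme term. For \<open>a\<close> it is
  \<open>M = {Min A}\<close>, whose only block is \<open>A\<close>, while all other \<open>M\<close>
  have smaller blocks. For \<open>p\<close> it is \<open>M = A\<close>, while all other
  \<open>M\<close> have fewer elements.\<close>

lemma inversion_determines:
  fixes p q a b :: "nat \<Rightarrow> int"
  assumes pa: "\<And>A. finite A \<Longrightarrow> card A \<ge> 2 \<Longrightarrow> (\<Sum>M \<in> Pow A. conv p a A M) = 0"
    and qb: "\<And>A. finite A \<Longrightarrow> card A \<ge> 2 \<Longrightarrow> (\<Sum>M \<in> Pow A. conv q b A M) = 0"
    and init: "p 0 = q 0" "p 1 = 1" "q 1 = 1" "a 0 = b 0" "a 1 = 1" "b 1 = 1"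
    and nonneg: "\<And>n. a n \<ge> 0"
  shows "p = q \<longleftrightarrow> a = b"
proof
  assume eq: "p = q"
  have "a n = b n" for n
  proof (induction n rule: less_induct)
    case (less n)
    show ?case
    proof (cases "n \<ge> 2")
      case True
      define A where "A = {1..n}"
      have A: "finite A" "card A = n" "A \<noteq> {}" using True by (auto simp: A_def)
      have sum: "(\<Sum>M \<in> Pow A. f M) = f {Min A} + (\<Sum>M \<in> Pow A - {{Min A}}. f M)" for f :: "nat set \<Rightarrow> int"
        using A by (intro sum.remove) auto
      have "conv p a A M = conv q b A M" if "M \<in> Pow A - {{Min A}}" for M
      proof -
        have "a (card (B i)) = b (card (B i))" if "B \<in> blocks M A" "i \<in> M" for B i
          using less card_block_less[OF A(1) _ _ that] \<open>M \<in> Pow A - {{Min A}}\<close> A(2) by auto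
        then show ?thesis unfolding conv_def eq by simp
      qed
      then have "conv p a A {Min A} = conv q b A {Min A}"
        using pa[OF A(1)] qb[OF A(1)] True A(2) sum[of "conv p a A"] sum[of "conv q b A"] by simp
      then show ?thesis using init by (simp add: conv_def blocks_Min[OF A(1,3)] A(2))
    next
      case False
      then have "n = 0 \<or> n = 1" by auto
      then show ?thesis using init by auto
    qed
  qed
  then show "a = b" by blast
next
  assume eq: "a = b"
  have "p n = q n" for n
  proof (induction n rule: less_induct)
    case (less n)
    show ?case
    proof (cases "n \<ge> 2")
      case True
      define A where "A = {1..n}"
      have A: "finite A" "card A = n" using True by (auto simp: A_def)
      have sum: "(\<Sum>M \<in> Pow A. f M) = f A + (\<Sum>M \<in> Pow A - {A}. f M)" for f :: "nat set \<Rightarrow> int"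
        using A by (intro sum.remove) auto
      have "conv p a A M = conv q b A M" if "M \<in> Pow A - {A}" for M
      proof -
        have "card M < n" using that A psubset_card_mono[of A M] by auto
        then show ?thesis unfolding conv_def eq by (simp add: less)
      qed
      then have "conv p a A A = conv q b A A"
        using pa[OF A(1)] qb[OF A(1)] True A(2) sum[of "conv p a A"] sum[of "conv q b A"] by simp
      \<comment> \<open>This is the coefficient of \<open>p n\<close>, to be cancelled. The
        partition into singletons contributes 1, and \<open>nonneg\<close> keeps other summands from
        cancelling it.\<close>
      moreover have "(\<Sum>B \<in> blocks A A. \<Prod>i\<in>A. b (card (B i))) \<noteq> 0"
      proof -
        have "(\<Prod>i\<in>A. b (card ((\<lambda>i\<in>A. {i}) i))) \<le> (\<Sum>B \<in> blocks A A. \<Prod>i\<in>A. b (card (B i)))"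
          using singleton_blocks[OF A(1)] nonneg finite_blocks[OF A(1) A(1)] unfolding eq
          by (intro member_le_sum prod_nonneg) (auto simp del: restrict_apply)
        moreover have "(\<Prod>i\<in>A. b (card ((\<lambda>i\<in>A. {i}) i))) = 1" using init by simp
        ultimately show ?thesis by linarith
      qed
      ultimately show ?thesis using A(2) by (simp add: conv_def eq)
    next
      case False
      then have "n = 0 \<or> n = 1" by auto
      then show ?thesis using init by auto
    qed
  qed
  then show "p = q" by blast
qed

subsection \<open>Counting by colour and rank\<close>

text \<open>The recursion splits off both subtrees of the root: \<open>c\<close> is the root's colour and \<open>j\<close> the
  number of labels below the minimum \<open>m\<close> of the right subtree. These \<open>j\<close> labels lie on the left,
  together with \<open>i\<close> of the \<open>n - 1 - j\<close> labels above \<open>m\<close>; whether the left edge has kind \<open>L12\<close> or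
  \<open>L13\<close> depends on whether the corresponding rank \<open>k\<close> of the left subtree is below \<open>j\<close>.\<close>

function cnt :: "'x::finite edge set \<Rightarrow> nat \<Rightarrow> 'x \<Rightarrow> nat \<Rightarrow> nat" where
  "cnt E n c j = (if j = 0 \<or> n \<le> j then 0 else
     (\<Sum>i \<le> n - 1 - j. (n - 1 - j choose i) *
       (of_bool (j + i = 1) +
         (\<Sum>y \<in> UNIV. \<Sum>k < j + i. if ((if k < j then L12 else L13), c, y) \<in> E then cnt E (j + i) y k else 0)) *
       (of_bool (n - j - i = 1) +
         (\<Sum>y \<in> UNIV. \<Sum>k < n - j - i. if (R23, c, y) \<in> E then cnt E (n - j - i) y k else 0))))"
  by pat_completeness auto
termination by (relation "measure (\<lambda>(E, n, c, j). n)") auto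

declare cnt.simps [simp del]

text \<open>Counts the trees with \<open>n\<close> leaves that may hang on the left below colour
  \<open>c\<close> when \<open>j\<close> of their labels are smaller than the minimum of the right
  sibling. On the right the sibling does not matter, so \<open>cntr\<close> has no such
  argument.\<close>

definition cntl :: "'x::finite edge set \<Rightarrow> nat \<Rightarrow> 'x \<Rightarrow> nat \<Rightarrow> nat" where
  "cntl E n c j = of_bool (n = 1) +
    (\<Sum>y \<in> UNIV. \<Sum>k < n. if ((if k < j then L12 else L13), c, y) \<in> E then cnt E n y k else 0)"

definition cntr :: "'x::finite edge set \<Rightarrow> nat \<Rightarrow> 'x \<Rightarrow> nat" where
  "cntr E n c = of_bool (n = 1) + (\<Sum>y \<in> UNIV. \<Sum>k < n. if (R23, c, y) \<in> E then cnt E n y k else 0)"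

definition tot :: "'x::finite edge set \<Rightarrow> nat \<Rightarrow> nat" where
  "tot E n = of_bool (n = 1) + (\<Sum>y \<in> UNIV. \<Sum>k < n. cnt E n y k)"

lemma cnt_0 [simp]: "cnt E n c 0 = 0" and cnt_ge [simp]: "n \<le> j \<Longrightarrow> cnt E n c j = 0"
  by (simp_all add: cnt.simps)

lemma cnt_rec:
  assumes "0 < j" "j < n"
  shows "cnt E n c j = (\<Sum>i \<le> n - 1 - j. (n - 1 - j choose i) * cntl E (j + i) c j * cntr E (n - j - i) c)"
proof -
  have "\<not> (j = 0 \<or> n \<le> j)" using assms by simp
  then show ?thesis by (subst cnt.simps) (simp only: if_False cntl_def cntr_def)
qed

abbreviation rank :: "nat set \<Rightarrow> nat \<Rightarrow> nat" where
  "rank A m \<equiv> card {x \<in> A. x < m}"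

lemma rank_less:
  assumes "finite A" "m \<in> A" "m < m'"
  shows "rank A m < rank A m'"
proof (rule psubset_card_mono)
  have "m \<in> {x \<in> A. x < m'}" "m \<notin> {x \<in> A. x < m}" using assms by simp_all
  moreover have "{x \<in> A. x < m} \<subseteq> {x \<in> A. x < m'}" using assms(3) by (auto intro: less_trans)
  ultimately show "{x \<in> A. x < m} \<subset> {x \<in> A. x < m'}" by blast
qed (use assms in simp)

lemma rank_less_iff:
  assumes "finite A" "m \<in> A"
  shows "rank A m < rank A m' \<longleftrightarrow> m < m'"
proof
  assume less: "rank A m < rank A m'"
  show "m < m'"
  proof (rule ccontr)
    assume "\<not> m < m'"
    then have "{x \<in> A. x < m'} \<subseteq> {x \<in> A. x < m}" by auto
    then have "rank A m' \<le> rank A m" using assms(1) by (intro card_mono) simp_all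
    then show False using less by simp
  qed
next
  assume "m < m'"
  then show "rank A m < rank A m'" by (rule rank_less[OF assms])
qed

lemma sum_rank:
  assumes "finite A"
  shows "(\<Sum>m\<in>A. g (rank A m)) = (\<Sum>k<card A. g k)"
proof -
  have inj: "inj_on (rank A) A"
  proof (rule inj_onI)
    fix m m' assume m: "m \<in> A" "m' \<in> A" "rank A m = rank A m'"
    show "m = m'"
      using rank_less_iff[OF assms m(1), of m'] rank_less_iff[OF assms m(2), of m] m(3) by simp
  qed
  have "rank A ` A \<subseteq> {..<card A}"
  proof
    fix k assume "k \<in> rank A ` A"
    then obtain m where m: "m \<in> A" "k = rank A m" by blast
    have "{x \<in> A. x < m} \<subset> A" using m(1) by blast
    then show "k \<in> {..<card A}" unfolding m(2) using assms by (simp add: psubset_card_mono)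
  qed
  then have "rank A ` A = {..<card A}"
    using card_image[OF inj] by (intro card_subset_eq) auto
  then show ?thesis using sum.reindex[OF inj, of g] by simp
qed

lemma sum_Pow_card:
  fixes g :: "nat \<Rightarrow> nat"
  assumes "finite H"
  shows "(\<Sum>X \<in> Pow H. g (card X)) = (\<Sum>i \<le> card H. (card H choose i) * g i)"
proof -
  have "(\<Sum>X \<in> Pow H. g (card X)) = (\<Sum>i \<le> card H. \<Sum>X \<in> {X \<in> Pow H. card X = i}. g (card X))"
    using assms by (intro sum.group[symmetric]) (auto intro: card_mono)
  also have "\<dots> = (\<Sum>i \<le> card H. (card H choose i) * g i)"
    using n_subsets[OF assms] by (intro sum.cong) auto
  finally show ?thesis .
qed

section \<open>Splitting trees at the root\<close>

definition rooted :: "nat set \<Rightarrow> 'x edge set \<Rightarrow> 'x \<Rightarrow> nat \<Rightarrow> 'x ltree set" where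
  "rooted A E c m = {T \<in> trees A E. \<exists>L R. T = Node c L R \<and> assigned R = m}"

lemma finite_rooted [simp]: "finite A \<Longrightarrow> finite (rooted A E c m :: 'x::finite ltree set)"
  by (simp add: rooted_def)

text \<open>In the applications \<open>P\<close> says that the edge to a given parent is allowed, or
  is trivial. A leaf has no such edge; for other trees the condition depends only on the root colour
  and the right minimum, as expressed by \<open>Q\<close>.\<close>

lemma card_by_root:
  fixes E :: "'x::finite edge set"
  assumes "finite A"
    and leaf: "\<And>i. P (Leaf i)"
    and node: "\<And>c m T. T \<in> rooted A E c m \<Longrightarrow> P T \<longleftrightarrow> Q c m"
  shows "card {T \<in> trees A E. P T} = of_bool (card A = 1) +
     (\<Sum>c \<in> UNIV. \<Sum>m \<in> A. if Q c m then card (rooted A E c m) else 0)"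
proof -
  let ?leaf = "{T. \<exists>i. A = {i} \<and> T = Leaf i} :: 'x ltree set"
  let ?node = "\<Union>(c, m) \<in> UNIV \<times> A. {T \<in> rooted A E c m. Q c m}"
  have "{T \<in> trees A E. P T} = ?leaf \<union> ?node"
  proof (intro equalityI subsetI)
    fix T assume T: "T \<in> {T \<in> trees A E. P T}"
    show "T \<in> ?leaf \<union> ?node"
    proof (cases T)
      case (Leaf i)
      then show ?thesis using T by (auto simp: trees_def)
    next
      case (Node c L R)
      then have r: "T \<in> rooted A E c (assigned R)" "assigned R \<in> A"
        using T assigned_in_leaves[of R] by (auto simp: rooted_def trees_def)
      moreover have "Q c (assigned R)" using node[OF r(1)] T by simp
      ultimately show ?thesis by blast
    qed
  next
    fix T assume "T \<in> ?leaf \<union> ?node"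
    then show "T \<in> {T \<in> trees A E. P T}"
    proof
      assume "T \<in> ?leaf"
      then show ?thesis using leaf by (auto simp: trees_def)
    next
      assume "T \<in> ?node"
      then show ?thesis using node by (auto simp: rooted_def)
    qed
  qed
  moreover have "?leaf \<inter> ?node = {}" by (auto simp: rooted_def)
  moreover have fl: "finite ?leaf" by (rule finite_subset[of _ "Leaf ` A"]) (use assms in auto)
  moreover have fn: "finite ?node" using assms(1) by auto
  ultimately have "card {T \<in> trees A E. P T} = card ?leaf + card ?node"
    by (simp add: card_Un_disjoint)
  also have "card ?leaf = of_bool (card A = 1)"
  proof (cases "card A = 1")
    case True
    then obtain i where "A = {i}" by (auto simp: card_1_singleton_iff)
    then show ?thesis by simp
  next
    case False
    then have "?leaf = {}" by auto
    then show ?thesis using False by (simp only: card.empty) simp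
  qed
  also have "card ?node = (\<Sum>(c, m) \<in> UNIV \<times> A. card {T \<in> rooted A E c m. Q c m})"
    unfolding case_prod_beta using assms(1)
    by (intro card_UN_disjoint) (auto simp: rooted_def)
  also have "\<dots> = (\<Sum>c \<in> UNIV. \<Sum>m \<in> A. if Q c m then card (rooted A E c m) else 0)"
    by (simp add: sum.cartesian_product[symmetric]) (intro sum.cong refl, simp)
  finally show ?thesis .
qed

text \<open>Since \<open>m\<close> is the minimum of the right subtree, all smaller labels lie on
  the left; \<open>X\<close> is the free choice of larger labels that join them.\<close>

lemma rooted_decompose:
  assumes "finite A" "m \<in> A" "rank A m > 0"
  shows "rooted A E c m = (\<Union>X \<in> Pow {x \<in> A. m < x}.
    (\<lambda>(L, R). Node c L R) `
      ({L \<in> trees ({x \<in> A. x < m} \<union> X) E. ledge c L m \<subseteq> E} \<times>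
       {R \<in> trees (A - ({x \<in> A. x < m} \<union> X)) E. redge c R \<subseteq> E}))" (is "_ = (\<Union>X \<in> _. ?f X)")
proof (intro equalityI subsetI)
  fix T assume "T \<in> rooted A E c m"
  then obtain L R where T: "T = Node c L R" "assigned R = m" "T \<in> trees A E"
    by (auto simp: rooted_def)
  let ?B = "set (leaves L)" and ?C = "set (leaves R)"
  let ?X = "{x \<in> ?B. m < x}"
  have d: "?B \<union> ?C = A" "?B \<inter> ?C = {}" using T by (auto simp: trees_def)
  have "m \<in> ?C" using T(2) assigned_in_leaves by blast
  moreover have "m \<le> x" if "x \<in> ?C" for x using that T(2) by (auto simp: assigned_def)
  ultimately have B: "?B = {x \<in> A. x < m} \<union> ?X" using d by (auto simp: not_le[symmetric])
  moreover have C: "?C = A - ({x \<in> A. x < m} \<union> ?X)" using d B by auto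
  ultimately have "T \<in> ?f ?X"
    using T unfolding trees_def by (intro image_eqI[of _ _ "(L, R)"]) auto
  moreover have "?X \<in> Pow {x \<in> A. m < x}" using d by auto
  ultimately show "T \<in> (\<Union>X \<in> Pow {x \<in> A. m < x}. ?f X)" by blast
next
  fix T assume "T \<in> (\<Union>X \<in> Pow {x \<in> A. m < x}. ?f X)"
  then obtain X where X: "X \<subseteq> {x \<in> A. m < x}" "T \<in> ?f X" by blast
  let ?B = "{x \<in> A. x < m} \<union> X"
  obtain L R where T: "T = Node c L R" "L \<in> trees ?B E" "ledge c L m \<subseteq> E"
    "R \<in> trees (A - ?B) E" "redge c R \<subseteq> E" using X(2) by auto
  have "assigned R = Min (A - ?B)" using T(4) by (simp add: trees_def assigned_def)
  also have "\<dots> = m" using assms X(1) by (intro Min_eqI) auto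
  finally have R: "assigned R = m" .
  \<comment> \<open>Positive rank provides a label below \<open>m\<close>. It lies on the left,
    which yields the condition of \<open>increasing\<close> at the root.\<close>
  obtain x where x: "x \<in> A" "x < m" using assms(3) by (auto simp: card_gt_0_iff)
  have "x \<in> set (leaves L)" using T(2) x by (simp add: trees_def)
  then have "assigned L \<le> x" by (simp add: assigned_def)
  then have "assigned L < m" using x by simp
  moreover have "?B \<union> (A - ?B) = A" using X(1) by auto
  ultimately show "T \<in> rooted A E c m" using T R by (auto simp: rooted_def trees_def)
qed

lemma card_rooted:
  fixes E :: "'x::finite edge set"
  assumes "finite A" "m \<in> A"
  shows "card (rooted A E c m) = cnt E (card A) c (rank A m)"
  using assms
proof (induction "card A" arbitrary: A c m rule: less_induct)
  case less
  show ?case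
  proof (cases "rank A m = 0")
    case True
    \<comment> \<open>Rank 0 makes \<open>m\<close> the minimum of \<open>A\<close>, but the left
      subtree would have to contain a smaller label.\<close>
    then have "\<not> x < m" if "x \<in> A" for x using that less.prems by auto
    then have "T \<notin> rooted A E c m" for T
      using assigned_in_leaves by (force simp: rooted_def trees_def)
    then have "rooted A E c m = {}" by blast
    then show ?thesis by (simp only: True cnt_0 card.empty)
  next
    case False
    let ?lo = "{x \<in> A. x < m}" and ?hi = "{x \<in> A. m < x}"
    let ?j = "card ?lo" and ?n = "card A"
    let ?l = "\<lambda>X. {L \<in> trees (?lo \<union> X) E. ledge c L m \<subseteq> E}"
    let ?r = "\<lambda>X. {R \<in> trees (A - (?lo \<union> X)) E. redge c R \<subseteq> E}"
    have A: "?lo \<union> ({m} \<union> ?hi) = A" using less.prems(2) by auto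
    have "card A = card ?lo + card ({m} \<union> ?hi)"
      using less.prems(1) by (subst card_Un_disjoint[symmetric]) (use A in auto)
    also have "card ({m} \<union> ?hi) = 1 + card ?hi"
      using less.prems(1) by (subst card_Un_disjoint) auto
    finally have "card A = card ?lo + (1 + card ?hi)" .
    then have hi: "card ?hi = ?n - 1 - ?j" and jn: "?j < ?n" by simp_all
    have XB: "finite (?lo \<union> X)" "card (?lo \<union> X) = ?j + card X" "card (A - (?lo \<union> X)) = ?n - ?j - card X"
      "rank (?lo \<union> X) m = ?j" "m \<notin> ?lo \<union> X" "card (?lo \<union> X) < ?n" "card (A - (?lo \<union> X)) < ?n"
      if X: "X \<in> Pow ?hi" for X
    proof -
      have finX: "finite X" using X less.prems(1) by (auto intro: finite_subset)
      show f: "finite (?lo \<union> X)" using finX less.prems(1) by simp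
      show cB: "card (?lo \<union> X) = ?j + card X"
        using X finX less.prems(1) by (intro card_Un_disjoint) auto
      have sub: "?lo \<union> X \<subseteq> A" using X by auto
      then show "card (A - (?lo \<union> X)) = ?n - ?j - card X" using cB f by (simp add: card_Diff_subset)
      show "card (A - (?lo \<union> X)) < ?n"
        using False less.prems(1) sub by (intro psubset_card_mono) (auto simp: card_gt_0_iff)
      show "m \<notin> ?lo \<union> X" using X by auto
      then show "card (?lo \<union> X) < ?n"
        using sub less.prems by (intro psubset_card_mono) auto
      have "{x \<in> ?lo \<union> X. x < m} = ?lo" using X by auto
      then show "rank (?lo \<union> X) m = ?j" by simp
    qed
    have l: "card (?l X) = cntl E (?j + card X) c ?j" if X: "X \<in> Pow ?hi" for X
    proof -
      let ?B = "?lo \<union> X"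
      have "card (?l X) = of_bool (card ?B = 1) + (\<Sum>y \<in> UNIV. \<Sum>k \<in> ?B.
          if ((if k < m then L12 else L13), c, y) \<in> E then card (rooted ?B E y k) else 0)"
        using XB(1)[OF X] by (rule card_by_root) (auto simp: rooted_def)
      \<comment> \<open>The left label set contains every label of \<open>A\<close> below
        \<open>m\<close>, so comparing \<open>k\<close> with \<open>m\<close> amounts to comparing
        its rank with \<open>?j\<close>.\<close>
      also have "\<dots> = of_bool (card ?B = 1) + (\<Sum>y \<in> UNIV. \<Sum>k \<in> ?B.
          if ((if rank ?B k < ?j then L12 else L13), c, y) \<in> E then cnt E (card ?B) y (rank ?B k) else 0)"
        using less.hyps[OF XB(6,1)[OF X]] rank_less_iff[OF XB(1)[OF X], of _ m] XB(4)[OF X]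
        by (intro arg_cong2[of _ _ _ _ "(+)"] sum.cong refl) simp
      also have "\<dots> = of_bool (card ?B = 1) + (\<Sum>y \<in> UNIV. \<Sum>k < card ?B.
          if ((if k < ?j then L12 else L13), c, y) \<in> E then cnt E (card ?B) y k else 0)"
        by (intro arg_cong2[of _ _ _ _ "(+)"] sum.cong refl sum_rank XB(1)[OF X]
             sum_rank[OF XB(1)[OF X], of "\<lambda>k. if ((if k < ?j then L12 else L13), c, _) \<in> E then cnt E (card ?B) _ k else 0"])
      finally show ?thesis unfolding cntl_def XB(2)[OF X] .
    qed
    have r: "card (?r X) = cntr E (?n - ?j - card X) c" if X: "X \<in> Pow ?hi" for X
    proof -
      let ?C = "A - (?lo \<union> X)"
      have fin: "finite ?C" using less.prems(1) by simp
      have "card (?r X) = of_bool (card ?C = 1) + (\<Sum>y \<in> UNIV. \<Sum>k \<in> ?C.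
          if (R23, c, y) \<in> E then card (rooted ?C E y k) else 0)"
        using fin by (rule card_by_root) (auto simp: rooted_def)
      also have "\<dots> = of_bool (card ?C = 1) + (\<Sum>y \<in> UNIV. \<Sum>k \<in> ?C.
          if (R23, c, y) \<in> E then cnt E (card ?C) y (rank ?C k) else 0)"
        using less.hyps[OF XB(7)[OF X] fin]
        by (intro arg_cong2[of _ _ _ _ "(+)"] sum.cong refl) simp
      also have "\<dots> = of_bool (card ?C = 1) + (\<Sum>y \<in> UNIV. \<Sum>k < card ?C.
          if (R23, c, y) \<in> E then cnt E (card ?C) y k else 0)"
        by (intro arg_cong2[of _ _ _ _ "(+)"] sum.cong refl
             sum_rank[OF fin, of "\<lambda>k. if (R23, c, _) \<in> E then cnt E (card ?C) _ k else 0"])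
      finally show ?thesis unfolding cntr_def XB(3)[OF X] .
    qed
    let ?f = "\<lambda>X. (\<lambda>(L, R). Node c L R) ` (?l X \<times> ?r X)"
    have "card (rooted A E c m) = (\<Sum>X \<in> Pow ?hi. card (?f X))"
      unfolding rooted_decompose[OF less.prems False[unfolded neq0_conv]]
    proof (rule card_UN_disjoint)
      show "finite (Pow ?hi)" using less.prems(1) by simp
      show "\<forall>X\<in>Pow ?hi. finite (?f X)"
        using XB(1) less.prems(1) by (intro ballI finite_imageI finite_cartesian_product) simp_all
      show "\<forall>X\<in>Pow ?hi. \<forall>Y\<in>Pow ?hi. X \<noteq> Y \<longrightarrow> ?f X \<inter> ?f Y = {}"
      proof (intro ballI impI)
        fix X Y assume XY: "X \<in> Pow ?hi" "Y \<in> Pow ?hi" "X \<noteq> Y"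
        moreover have "?hi \<inter> (?lo \<union> Z) = Z" if "Z \<in> Pow ?hi" for Z using that by auto
        ultimately have "?lo \<union> X \<noteq> ?lo \<union> Y" by metis
        then have "trees (?lo \<union> X) E \<inter> trees (?lo \<union> Y) E = {}" unfolding trees_def by blast
        then show "?f X \<inter> ?f Y = {}" by auto
      qed
    qed
    also have "\<dots> = (\<Sum>X \<in> Pow ?hi. cntl E (?j + card X) c ?j * cntr E (?n - ?j - card X) c)"
    proof (intro sum.cong refl)
      fix X assume X: "X \<in> Pow ?hi"
      have "card (?f X) = card (?l X \<times> ?r X)" by (rule card_image) (auto simp: inj_on_def)
      then show "card (?f X) = cntl E (?j + card X) c ?j * cntr E (?n - ?j - card X) c"
        by (simp only: card_cartesian_product l[OF X] r[OF X])
    qed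
    also have "\<dots> = (\<Sum>i \<le> card ?hi. (card ?hi choose i) * (cntl E (?j + i) c ?j * cntr E (?n - ?j - i) c))"
      using less.prems(1) by (intro sum_Pow_card[where g = "\<lambda>i. cntl E (?j + i) c ?j * cntr E (?n - ?j - i) c"]) simp
    also have "\<dots> = cnt E ?n c ?j"
      by (simp only: cnt_rec[OF False[unfolded neq0_conv] jn] hi mult.assoc)
    finally show ?thesis .
  qed
qed

theorem card_trees:
  fixes E :: "'x::finite edge set"
  assumes "finite A"
  shows "card (trees A E) = tot E (card A)"
proof -
  have "card {T \<in> trees A E. True} = of_bool (card A = 1) +
     (\<Sum>c \<in> UNIV. \<Sum>m \<in> A. if True then card (rooted A E c m) else 0)"
    using assms by (rule card_by_root) simp_all
  also have "\<dots> = of_bool (card A = 1) + (\<Sum>c \<in> UNIV. \<Sum>m \<in> A. cnt E (card A) c (rank A m))"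
    using card_rooted[OF assms] by (intro arg_cong2[of _ _ _ _ "(+)"] sum.cong refl) simp
  also have "\<dots> = tot E (card A)"
    by (simp add: tot_def sum_rank[OF assms, of "cnt E (card A) _"])
  finally show ?thesis by simp
qed

lemma tot_0 [simp]: "tot E 0 = 0" and tot_1 [simp]: "tot E (Suc 0) = 1"
  by (simp_all add: tot_def)

theorem Wilf_equivalent_iff_tot:
  fixes E F :: "'x::finite edge set"
  shows "Wilf_equivalent (pat ` E) (pat ` F) \<longleftrightarrow> tot E = tot F"
proof -
  let ?i = "\<lambda>f n. int (f n)"
  have inv: "(\<Sum>M \<in> Pow A. conv (?i (tot E)) (?i (tot (- E))) A M) = 0"
    if "finite A" "card A \<ge> 2" for A and E :: "'x edge set"
  proof -
    have fin: "finite M" if "M \<subseteq> A" for M using that \<open>finite A\<close> finite_subset by blast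
    have "(\<Sum>M \<in> Pow A. conv (?i (tot E)) (?i (tot (- E))) A M) =
       (\<Sum>M \<in> Pow A. (- 1) ^ card M * int (card (trees M E)) *
           (\<Sum>B \<in> blocks M A. \<Prod>i\<in>M. int (card (trees (B i) (- E)))))"
    proof (intro sum.cong refl)
      fix M assume M: "M \<in> Pow A"
      have "tot (- E) (card (B i)) = card (trees (B i) (- E))" if "B \<in> blocks M A" "i \<in> M" for B i
        using card_trees[of "B i" "- E"] blocks_subset[OF that] fin by simp
      then show "conv (?i (tot E)) (?i (tot (- E))) A M = (- 1) ^ card M * int (card (trees M E)) *
           (\<Sum>B \<in> blocks M A. \<Prod>i\<in>M. int (card (trees (B i) (- E))))"
        using M fin by (simp add: conv_def card_trees)
    qed
    then show ?thesis using inversion[OF that] by simp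
  qed
  have "Wilf_equivalent (pat ` E) (pat ` F) \<longleftrightarrow> (\<forall>l. tot (- E) l = tot (- F) l)"
    by (simp add: Wilf_equivalent_def LT_avoids card_trees)
  also have "\<dots> \<longleftrightarrow> ?i (tot (- E)) = ?i (tot (- F))"
    by (simp add: fun_eq_iff)
  also have "\<dots> \<longleftrightarrow> ?i (tot E) = ?i (tot F)"
    by (rule inversion_determines[symmetric]) (auto intro: inv)
  also have "\<dots> \<longleftrightarrow> tot E = tot F"
    by (simp add: fun_eq_iff)
  finally show ?thesis .
qed

subsection \<open>Closed forms\<close>

lemma UNIV_colour: "c \<noteq> d \<Longrightarrow> (UNIV :: colour set) = {c, d}"
  using colour.exhaust by (metis (full_types) UNIV_eq_I insertCI)

lemma sum_colour: "c \<noteq> d \<Longrightarrow> (\<Sum>y \<in> UNIV. g y) = g c + g (d :: colour)"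
  by (simp add: UNIV_colour[of c d])

lemma card_UNIV_colour: "card (UNIV :: colour set) = 2"
  by (simp add: UNIV_colour[of White Black])

lemma colour_cases: "c \<noteq> d \<Longrightarrow> y = c \<or> y = (d :: colour)"
  using UNIV_colour[of c d] by blast

lemma cntl_1 [simp]: "cntl E (Suc 0) c j = 1"
  by (simp add: cntl_def)

lemma cntr_1 [simp]: "cntr E (Suc 0) c = 1"
  by (simp add: cntr_def)

lemma cnt_2: "cnt E 2 c j = of_bool (j = 1)"
proof -
  consider "j = 0" | "j = 1" | "j \<ge> 2" by linarith
  then show ?thesis by cases (simp_all add: cnt_rec)
qed

lemma cntl_split:
  assumes "n \<ge> 2" "j \<le> n"
  shows "cntl E n c j = (\<Sum>y \<in> UNIV.
    (if (L12, c, y) \<in> E then \<Sum>k<j. cnt E n y k else 0) +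
    (if (L13, c, y) \<in> E then \<Sum>k=j..<n. cnt E n y k else 0))"
proof -
  have "(\<Sum>k<n. if ((if k < j then L12 else L13), c, y) \<in> E then cnt E n y k else 0) =
      (if (L12, c, y) \<in> E then \<Sum>k<j. cnt E n y k else 0) +
      (if (L13, c, y) \<in> E then \<Sum>k=j..<n. cnt E n y k else 0)" for y
  proof -
    have "(\<Sum>k<n. if ((if k < j then L12 else L13), c, y) \<in> E then cnt E n y k else 0) =
      (\<Sum>k<j. if ((if k < j then L12 else L13), c, y) \<in> E then cnt E n y k else 0) +
      (\<Sum>k=j..<n. if ((if k < j then L12 else L13), c, y) \<in> E then cnt E n y k else 0)"
      unfolding lessThan_atLeast0 using assms(2) by (intro sum.atLeastLessThan_concat[symmetric]) auto
    also have "\<dots> = (\<Sum>k<j. if (L12, c, y) \<in> E then cnt E n y k else 0) +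
      (\<Sum>k=j..<n. if (L13, c, y) \<in> E then cnt E n y k else 0)"
      by (intro arg_cong2[of _ _ _ _ "(+)"] sum.cong refl) auto
    finally show ?thesis by simp
  qed
  then show ?thesis using assms(1) by (simp add: cntl_def)
qed

lemma cntr_ge_2:
  "n \<ge> 2 \<Longrightarrow> cntr E n c = (\<Sum>y \<in> UNIV. if (R23, c, y) \<in> E then \<Sum>k<n. cnt E n y k else 0)"
  by (simp add: cntr_def if_distrib cong: if_cong) (intro sum.cong refl, simp)

text \<open>The right subtree is a single leaf, so the other \<open>n - 1\<close> labels are all on
  the left.\<close>

lemma cnt_no_R:
  assumes "\<And>y. (R23, c, y) \<notin> E" "0 < j" "j < n"
  shows "cnt E n c j = cntl E (n - 1) c j"
proof -
  have "cntr E m c = of_bool (m = 1)" for m using assms(1) by (simp add: cntr_def)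
  then have "cnt E n c j = (\<Sum>i \<le> n - 1 - j. if i = n - 1 - j then cntl E (n - 1) c j else 0)"
    using assms(2,3) unfolding cnt_rec[OF assms(2,3)] by (intro sum.cong refl) auto
  then show ?thesis by simp
qed

text \<open>The left subtree is a single leaf carrying the overall minimum, so exactly one label is
  below the right minimum.\<close>

lemma cnt_no_L:
  assumes "\<And>y. (L12, c, y) \<notin> E" "\<And>y. (L13, c, y) \<notin> E" "n \<ge> 2"
  shows "cnt E n c j = of_bool (j = 1) * cntr E (n - 1) c"
proof (cases "0 < j \<and> j < n")
  case True
  have "cntl E m c j = of_bool (m = 1)" for m using assms(1,2) by (simp add: cntl_def)
  then have "cnt E n c j = (\<Sum>i \<le> n - 1 - j. if i = 0 then of_bool (j = 1) * cntr E (n - 1) c else 0)"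
    using True by (subst cnt_rec, simp, simp, intro sum.cong refl) (auto split: if_splits)
  then show ?thesis by simp
next
  case False
  then show ?thesis using assms(3) by auto
qed

lemma cnt_no_child:
  assumes "\<And>t y. (t, c, y) \<notin> E" "n \<ge> 2"
  shows "cnt E n c j = of_bool (n = 2 \<and> j = 1)"
  using assms by (subst cnt_no_L) (auto simp: cntr_def)

lemma tot_ge_2: "n \<ge> 2 \<Longrightarrow> tot E n = (\<Sum>y \<in> UNIV. \<Sum>k<n. cnt E n y k)"
  by (simp add: tot_def)

text \<open>Walks with \<open>n\<close> steps from \<open>c\<close> in the directed graph
  \<open>D\<close> on the colours.\<close>

fun words :: "('x::finite \<times> 'x) set \<Rightarrow> nat \<Rightarrow> 'x \<Rightarrow> nat" where
  "words D 0 c = 1"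
| "words D (Suc n) c = (\<Sum>y \<in> UNIV. of_bool ((c, y) \<in> D) * words D n y)"

text \<open>Here every tree with all edges in \<open>E\<close> is a path of internal vertices and is determined by
  their colours: \<open>late c\<close> states whether the right subtree of the root, of colour \<open>c\<close>, has the
  largest or the smallest possible minimum.\<close>

lemma tot_linear:
  fixes E :: "'x::finite edge set"
  assumes lin: "\<And>c. (\<forall>y. (R23, c, y) \<notin> E) \<or> (\<forall>y. (L12, c, y) \<notin> E \<and> (L13, c, y) \<notin> E)"
    and e12: "\<And>c y. (L12, c, y) \<in> E \<Longrightarrow> late c \<and> late y"
    and e13: "\<And>c y. (L13, c, y) \<in> E \<Longrightarrow> \<not> late c \<and> \<not> late y"
    and e23: "\<And>c y. (R23, c, y) \<in> E \<Longrightarrow> \<not> late c"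
  shows "tot E (n + 2) = (\<Sum>c \<in> UNIV. words {(c, y). \<exists>t. (t, c, y) \<in> E} n c)"
proof -
  define D where "D = {(c, y). \<exists>t. (t, c, y) \<in> E}"
  have mem: "(c, y) \<in> D \<longleftrightarrow> (\<exists>t. (t, c, y) \<in> E)" for c y by (simp add: D_def)
  \<comment> \<open>A path with \<open>n + 2\<close> leaves has \<open>n + 1\<close> internal
    vertices, hence a walk of \<open>n\<close> steps; the rank at its root lies between 1 and
    \<open>n + 1\<close>.\<close>
  have cnt: "cnt E (n + 2) c j = (if j = (if late c then n + 1 else 1) then words D n c else 0)" for n c j
  proof (induction n arbitrary: c j)
    case 0
    then show ?case by (simp add: cnt_2[unfolded numeral_2_eq_2] numeral_2_eq_2)
  next
    case (Suc n)
    let ?p = "\<lambda>y. if late y then n + 1 else 1"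
    show ?case
    proof (cases "0 < j \<and> j < Suc n + 2")
      case True
      show ?thesis
      proof (cases "\<forall>y. (R23, c, y) \<notin> E")
        case noR: True
        have "cnt E (Suc n + 2) c j = cntl E (n + 2) c j"
          using cnt_no_R[of c E j "Suc n + 2"] noR True by simp
        also have "\<dots> = (\<Sum>y \<in> UNIV. \<Sum>k < n + 2. if k = ?p y then
            (if ((if k < j then L12 else L13), c, y) \<in> E then words D n y else 0) else 0)"
        proof -
          have "cntl E (n + 2) c j = (\<Sum>y \<in> UNIV. \<Sum>k < n + 2.
              if ((if k < j then L12 else L13), c, y) \<in> E then cnt E (n + 2) y k else 0)"
            unfolding cntl_def by simp
          then show ?thesis by (simp only: Suc) (intro sum.cong refl, simp)
        qed
        also have "\<dots> = (\<Sum>y \<in> UNIV. if ((if ?p y < j then L12 else L13), c, y) \<in> E then words D n y else 0)"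
          by (intro sum.cong refl, subst sum.delta) auto
        also have "\<dots> = (\<Sum>y \<in> UNIV. if j = (if late c then Suc n + 1 else 1)
            then of_bool ((c, y) \<in> D) * words D n y else 0)"
        proof (intro sum.cong refl)
          fix y
          have D: "(c, y) \<in> D \<longleftrightarrow> (if late c then L12 else L13, c, y) \<in> E"
          proof
            assume "(c, y) \<in> D"
            then obtain t where t: "(t, c, y) \<in> E" using mem by blast
            show "(if late c then L12 else L13, c, y) \<in> E"
              using t noR e12[of c y] e13[of c y] by (cases t) auto
          qed (use mem in blast)
          \<comment> \<open>If \<open>late c\<close>, the child has rank \<open>n + 1\<close> and
            kind \<open>L12\<close> forces \<open>j = n + 2\<close>; otherwise the child has rank 1
            and kind \<open>L13\<close> forces \<open>j = 1\<close>.\<close>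
          show "(if ((if ?p y < j then L12 else L13), c, y) \<in> E then words D n y else 0) =
            (if j = (if late c then Suc n + 1 else 1) then of_bool ((c, y) \<in> D) * words D n y else 0)"
            unfolding D using True e12[of c y] e13[of c y] by (auto split: if_splits)
        qed
        also have "\<dots> = (if j = (if late c then Suc n + 1 else 1) then words D (Suc n) c else 0)"
          by (cases "j = (if late c then Suc n + 1 else 1)")
            (simp_all only: words.simps simp_thms if_True if_False sum.neutral_const)
        finally show ?thesis .
      next
        case False
        then have noL: "(L12, c, y) \<notin> E" "(L13, c, y) \<notin> E" for y using lin by blast+
        have l: "\<not> late c" using False e23 by blast
        have "cnt E (Suc n + 2) c j = of_bool (j = 1) * cntr E (n + 2) c"
          using cnt_no_L[of c E "Suc n + 2" j] noL by simp
        also have "cntr E (n + 2) c = (\<Sum>y \<in> UNIV. if (R23, c, y) \<in> E then words D n y else 0)"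
        proof -
          have "(\<Sum>k<n + 2. cnt E (n + 2) y k) = words D n y" for y
            unfolding Suc by (subst sum.delta) auto
          then show ?thesis by (subst cntr_ge_2) (simp_all only: le_add2)
        qed
        also have "\<dots> = words D (Suc n) c"
        proof -
          have "(R23, c, y) \<in> E \<longleftrightarrow> (c, y) \<in> D" for y
          proof
            assume "(c, y) \<in> D"
            then obtain t where "(t, c, y) \<in> E" using mem by blast
            then show "(R23, c, y) \<in> E" using noL[of y] by (cases t) auto
          qed (use mem in blast)
          moreover have "of_bool P * w = (if P then w else 0)" for P and w :: nat by simp
          ultimately show ?thesis by (simp only: words.simps)
        qed
        finally show ?thesis using l by simp
      qed
    next
      case False
      then show ?thesis by auto
    qed
  qed
  have "(\<Sum>k<n + 2. cnt E (n + 2) y k) = words D n y" for y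
    unfolding cnt by (subst sum.delta) auto
  then show ?thesis by (simp only: tot_ge_2 le_add2 D_def)
qed

lemma nat_seq_eqI:
  fixes f g :: "nat \<Rightarrow> 'a"
  assumes "f 0 = g 0" "f 1 = g 1" "\<And>n. f (n + 2) = g (n + 2)"
  shows "f = g"
proof
  fix n :: nat
  consider "n = 0" | "n = 1" | "n = (n - 2) + 2" by linarith
  then show "f n = g n" using assms by cases (simp_all, metis)
qed

section \<open>Pairs and single edges whose trees are paths determined by their colours\<close>

definition two_seq :: "nat \<Rightarrow> nat" where
  "two_seq n = (if n \<le> 1 then n else 2)"

text \<open>If both arcs leave the same colour, they lead to both colours and the total number of
  walks is preserved at each step. Otherwise each colour has exactly one outgoing arc, hence one
  walk of each length.\<close>

lemma words_two:
  fixes a b a' b' :: colour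
  assumes "(a, b) \<noteq> (a', b')"
  shows "(\<Sum>c \<in> UNIV. words {(a, b), (a', b')} n c) = 2"
proof (cases "a = a'")
  case True
  then have b: "b \<noteq> b'" using assms by simp
  obtain d where d: "a \<noteq> d" by (cases a) auto
  show ?thesis
  proof (induction n)
    case (Suc n)
    have "words {(a, b), (a', b')} (Suc n) d = 0" using d True by simp
    moreover have "words {(a, b), (a', b')} (Suc n) a = (\<Sum>c \<in> UNIV. words {(a, b), (a', b')} n c)"
      using b by (simp add: sum_colour[OF b] True)
    ultimately show ?case using Suc by (simp only: sum_colour[OF d])
  qed (simp add: card_UNIV_colour)
next
  case False
  have "words {(a, b), (a', b')} n c = 1" for c
  proof (induction n arbitrary: c)
    case (Suc n)
    have "c = a \<or> c = a'" using colour_cases[OF False] .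
    then show ?case using False by (auto simp: Suc of_bool_def)
  qed simp
  then show ?thesis by (simp add: card_UNIV_colour)
qed

lemma tot_two_seqI:
  fixes E :: "colour edge set"
  assumes "\<And>c. (\<forall>y. (R23, c, y) \<notin> E) \<or> (\<forall>y. (L12, c, y) \<notin> E \<and> (L13, c, y) \<notin> E)"
    and "\<And>c y. (L12, c, y) \<in> E \<Longrightarrow> late c \<and> late y"
    and "\<And>c y. (L13, c, y) \<in> E \<Longrightarrow> \<not> late c \<and> \<not> late y"
    and "\<And>c y. (R23, c, y) \<in> E \<Longrightarrow> \<not> late c"
    and E: "E = {(t, a, b), (t', a', b')}" "(a, b) \<noteq> (a', b')"
  shows "tot E = two_seq"
proof (rule nat_seq_eqI)
  fix n
  have "{(c, y). \<exists>t. (t, c, y) \<in> E} = {(a, b), (a', b')}" unfolding E by auto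
  then show "tot E (n + 2) = two_seq (n + 2)"
    using tot_linear[OF assms(1-4), where n = n] words_two[OF E(2), of n] by (simp add: two_seq_def)
qed (simp_all add: two_seq_def)

lemma tot_same_kind:
  "(a, b) \<noteq> (a', b') \<Longrightarrow> tot {(t, a, b), (t, a', b')} = two_seq" for a b a' b' :: colour
  by (rule tot_two_seqI[OF _ _ _ _ refl, where late = "\<lambda>_. t = L12"]) (cases t, auto)+

lemma tot_L12_L13_two:
  "c \<noteq> d \<Longrightarrow> tot {(L12, c, c), (L13, d, d)} = two_seq" for c d :: colour
  by (rule tot_two_seqI[OF _ _ _ _ refl, where late = "\<lambda>x. x = c"]) auto

lemma tot_L12_R23_two:
  "c \<noteq> d \<Longrightarrow> tot {(L12, c, c), (R23, d, y)} = two_seq" for c d y :: colour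
  by (rule tot_two_seqI[OF _ _ _ _ refl, where late = "\<lambda>x. x = c"]) auto

lemma tot_L13_R23_two:
  "c \<noteq> d \<Longrightarrow> tot {(L13, c, x), (R23, d, y)} = two_seq" for c d x y :: colour
  by (rule tot_two_seqI[OF _ _ _ _ refl, where late = "\<lambda>_. False"]) auto

definition one_seq :: "nat \<Rightarrow> nat" where
  "one_seq n = (if n \<le> 2 then n else 1)"

definition short_seq :: "nat \<Rightarrow> nat" where
  "short_seq n = (if n \<le> 2 then n else if n = 3 then 1 else 0)"

text \<open>A loop at \<open>a\<close> gives one walk of every length; an arc between different
  colours allows no walk of two steps. At \<open>n = 2\<close> both colours count, by the empty
  walk.\<close>

lemma tot_single:
  fixes a b :: colour
  shows "tot {(t, a, b)} = (if a = b then one_seq else short_seq)"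
proof (rule nat_seq_eqI)
  fix n
  obtain d where d: "a \<noteq> d" by (cases a) auto
  have "{(c, y). \<exists>s. (s, c, y) \<in> {(t, a, b)}} = {(a, b)}" by auto
  then have tot: "tot {(t, a, b)} (n + 2) = words {(a, b)} n a + words {(a, b)} n d"
    by (subst tot_linear[where late = "\<lambda>_. t = L12"]) (cases t; force simp: sum_colour[OF d])+
  have d0: "words {(a, b)} (Suc n) d = 0" for n using d by simp
  have a: "words {(a, b)} (Suc n) a = words {(a, b)} n b" for n
    using d colour_cases[OF d, of b] by (auto simp: sum_colour[OF d])
  have d': "words {(a, b)} n d = of_bool (n = 0)" for n
    using d0 by (cases n) (simp_all del: words.simps(2))
  show "tot {(t, a, b)} (n + 2) = (if a = b then one_seq else short_seq) (n + 2)"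
  proof (cases "a = b")
    case True
    have "words {(a, b)} n a = 1" for n
      using True a by (induction n) auto
    then show ?thesis unfolding tot d' using True by (simp add: one_seq_def)
  next
    case False
    then have "b = d" using colour_cases[OF d, of b] by auto
    then have "words {(a, b)} n a = of_bool (n \<le> 1)"
      using a d' by (cases n) (simp_all del: words.simps(2))
    then show ?thesis unfolding tot d' using False by (simp add: short_seq_def)
  qed
qed (simp_all add: one_seq_def short_seq_def)

lemma cnt_2_Suc: "cnt E (Suc (Suc 0)) c j = of_bool (j = 1)"
  using cnt_2[of E c j] by (simp only: numeral_2_eq_2)

section \<open>Pairs of edges giving n - 1 trees\<close>

definition lin_seq :: "nat \<Rightarrow> nat" where
  "lin_seq n = (if n \<le> 2 then n else n - 1)"

lemma nat_seq_eqI3: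
  fixes f g :: "nat \<Rightarrow> 'a"
  assumes "f 0 = g 0" "f 1 = g 1" "f 2 = g 2" "\<And>n. f (Suc (Suc (Suc n))) = g (Suc (Suc (Suc n)))"
  shows "f = g"
proof
  fix n :: nat
  consider "n = 0" | "n = 1" | "n = 2" | m where "n = Suc (Suc (Suc m))"
    by (metis One_nat_def numeral_2_eq_2 not0_implies_Suc)
  then show "f n = g n" by cases (use assms in simp_all)
qed

lemma tot_2: "tot E 2 = 2" for E :: "colour edge set"
proof -
  have "(\<Sum>k<2. cnt E 2 c k) = 1" for c by (simp add: numeral_2_eq_2 cnt_2_Suc)
  then show ?thesis by (simp only: tot_ge_2 order_refl sum_constant card_UNIV_colour) simp
qed

lemma tot_lin_seqI:
  fixes E :: "colour edge set"
  assumes "\<And>n. (\<Sum>y \<in> UNIV. \<Sum>k < Suc (Suc (Suc n)). cnt E (Suc (Suc (Suc n))) y k) = n + 2"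
  shows "tot E = lin_seq"
proof (rule nat_seq_eqI3)
  show "tot E (Suc (Suc (Suc n))) = lin_seq (Suc (Suc (Suc n)))" for n
    using assms[of n] tot_ge_2[of "Suc (Suc (Suc n))" E] by (simp add: lin_seq_def)
qed (simp_all add: lin_seq_def tot_2)

text \<open>With three successors the left subtree has at least two leaves, so the single-leaf term
  of \<open>cntl\<close> is absent.\<close>

lemma cnt_step:
  assumes "\<And>y. (R23, c, y) \<notin> E"
  shows "cnt E (Suc (Suc (Suc n))) c j = (if 0 < j \<and> j < Suc (Suc (Suc n)) then (\<Sum>y \<in> UNIV.
    (if (L12, c, y) \<in> E then \<Sum>k<j. cnt E (Suc (Suc n)) y k else 0) +
    (if (L13, c, y) \<in> E then \<Sum>k=j..<Suc (Suc n). cnt E (Suc (Suc n)) y k else 0)) else 0)"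
proof (cases "0 < j \<and> j < Suc (Suc (Suc n))")
  case True
  then have "cnt E (Suc (Suc (Suc n))) c j = cntl E (Suc (Suc n)) c j"
    using cnt_no_R[of c E j "Suc (Suc (Suc n))"] assms by simp
  then show ?thesis using cntl_split[of "Suc (Suc n)" j E c] True by simp
qed auto

lemma sum_delta_less: "(\<Sum>k<j. if k = a then x else 0) = (if a < j then x else 0)" for j :: nat
  by (subst sum.delta) auto

lemma sum_delta_ivl: "(\<Sum>k=i..<j. if k = a then x else 0) = (if i \<le> a \<and> a < j then x else 0)" for i :: nat
  by (subst sum.delta) auto

lemma sum_count: "a < m \<Longrightarrow> (\<Sum>k<m. if b < k \<and> k \<le> a then 1 else 0) = a - b" for a b m :: nat
proof -
  assume "a < m"
  then have "{..<m} \<inter> {k. b < k \<and> k \<le> a} = {b<..a}" by auto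
  then show ?thesis by (simp add: sum.If_cases)
qed

context
  fixes c d :: colour
  assumes cd: "c \<noteq> d"
begin

text \<open>Colour \<open>d\<close> has no internal child, so \<open>L13\<close> occurs at most at
  the bottom of a chain of colour \<open>c\<close>. From three leaves on, the recursion for
  \<open>L12\<close> keeps all trees at the top two ranks and only one of them at the lower.\<close>

lemma tot_lin_1: "tot {(L12, c, c), (L13, c, d)} = lin_seq"
proof -
  let ?E = "{(L12, c, c), (L13, c, d)}"
  have d: "cnt ?E n d j = of_bool (n = 2 \<and> j = 1)" if "n \<ge> 2" for n j
    using that cd by (intro cnt_no_child) auto
  have step: "cnt ?E (Suc (Suc (Suc n))) c j = (if 0 < j \<and> j < Suc (Suc (Suc n)) then
     (\<Sum>k<j. cnt ?E (Suc (Suc n)) c k) + (\<Sum>k=j..<Suc (Suc n). cnt ?E (Suc (Suc n)) d k) else 0)" for n j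
    using cd by (subst cnt_step) (simp_all add: sum_colour[OF cd] del: sum.op_ivl_Suc sum.lessThan_Suc)
  have c: "cnt ?E (Suc (Suc (Suc n))) c j = (if j = n + 2 then n + 1 else 0) + (if j = n + 1 then 1 else 0)" for n j
  proof (induction n arbitrary: j)
    case 0
    consider "j = 0" | "j = 1" | "j = 2" | "j \<ge> 3" by linarith
    then show ?case by cases (simp_all add: step cnt_2_Suc numeral_2_eq_2)
  next
    case (Suc n)
    show ?case unfolding step[of "Suc n"] d[of "Suc (Suc (Suc n))", simplified] Suc
      by (auto simp: sum.distrib sum_delta_less simp del: sum.lessThan_Suc)
  qed
  show ?thesis
  proof (rule tot_lin_seqI)
    show "(\<Sum>y \<in> UNIV. \<Sum>k < Suc (Suc (Suc n)). cnt ?E (Suc (Suc (Suc n))) y k) = n + 2" for n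
      by (simp add: sum_colour[OF cd] c d sum.distrib sum_delta_less del: sum.lessThan_Suc)
  qed
qed

text \<open>Colour \<open>d\<close> occurs only at the root. Below it hangs the unique chain of
  colour \<open>c\<close>, of largest rank, so \<open>L13\<close> allows every root rank up to that
  one.\<close>

lemma tot_lin_2: "tot {(L12, c, c), (L13, d, c)} = lin_seq"
proof -
  let ?E = "{(L12, c, c), (L13, d, c)}"
  have step: "cnt ?E (Suc (Suc (Suc n))) c j = (if 0 < j \<and> j < Suc (Suc (Suc n)) then
       (\<Sum>k<j. cnt ?E (Suc (Suc n)) c k) else 0)"
     "cnt ?E (Suc (Suc (Suc n))) d j = (if 0 < j \<and> j < Suc (Suc (Suc n)) then
       (\<Sum>k=j..<Suc (Suc n). cnt ?E (Suc (Suc n)) c k) else 0)" for n j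
    using cd by (subst cnt_step; simp add: sum_colour[OF cd] del: sum.op_ivl_Suc sum.lessThan_Suc)+
  have c: "cnt ?E (Suc (Suc n)) c j = (if j = n + 1 then 1 else 0)" for n j
  proof (induction n arbitrary: j)
    case (Suc n)
    show ?case unfolding step(1)[of n] Suc
      by (auto simp: sum_delta_less simp del: sum.lessThan_Suc)
  qed (simp add: cnt_2_Suc)
  have d: "cnt ?E (Suc (Suc (Suc n))) d j = (if 0 < j \<and> j \<le> n + 1 then 1 else 0)" for n j
    unfolding step(2) c by (auto simp: sum_delta_ivl simp del: sum.op_ivl_Suc)
  show ?thesis
  proof (rule tot_lin_seqI)
    show "(\<Sum>y \<in> UNIV. \<Sum>k < Suc (Suc (Suc n)). cnt ?E (Suc (Suc (Suc n))) y k) = n + 2" for n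
      by (simp add: sum_colour[OF cd] c d sum_delta_less sum_count del: sum.lessThan_Suc)
  qed
qed

text \<open>The analogue of \<open>tot_lin_1\<close> with the two left kinds exchanged: the trees
  now sit at the lowest two ranks.\<close>

lemma tot_lin_3: "tot {(L12, c, d), (L13, c, c)} = lin_seq"
proof -
  let ?E = "{(L12, c, d), (L13, c, c)}"
  have d: "cnt ?E n d j = of_bool (n = 2 \<and> j = 1)" if "n \<ge> 2" for n j
    using that cd by (intro cnt_no_child) auto
  have step: "cnt ?E (Suc (Suc (Suc n))) c j = (if 0 < j \<and> j < Suc (Suc (Suc n)) then
     (\<Sum>k<j. cnt ?E (Suc (Suc n)) d k) + (\<Sum>k=j..<Suc (Suc n). cnt ?E (Suc (Suc n)) c k) else 0)" for n j
    using cd by (subst cnt_step) (simp_all add: sum_colour[OF cd] del: sum.op_ivl_Suc sum.lessThan_Suc)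
  have c: "cnt ?E (Suc (Suc (Suc n))) c j = (if j = 1 then n + 1 else 0) + (if j = 2 then 1 else 0)" for n j
  proof (induction n arbitrary: j)
    case 0
    consider "j = 0" | "j = 1" | "j = 2" | "j \<ge> 3" by linarith
    then show ?case by cases (simp_all add: step cnt_2_Suc numeral_2_eq_2)
  next
    case (Suc n)
    show ?case unfolding step[of "Suc n"] d[of "Suc (Suc (Suc n))", simplified] Suc
      by (auto simp: sum.distrib sum_delta_ivl simp del: sum.op_ivl_Suc)
  qed
  show ?thesis
  proof (rule tot_lin_seqI)
    show "(\<Sum>y \<in> UNIV. \<Sum>k < Suc (Suc (Suc n)). cnt ?E (Suc (Suc (Suc n))) y k) = n + 2" for n
      by (simp add: sum_colour[OF cd] c d sum.distrib sum_delta_less del: sum.lessThan_Suc)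
  qed
qed

lemma tot_lin_4: "tot {(L12, c, d), (L13, d, d)} = lin_seq"
proof -
  let ?E = "{(L12, c, d), (L13, d, d)}"
  have step: "cnt ?E (Suc (Suc (Suc n))) c j = (if 0 < j \<and> j < Suc (Suc (Suc n)) then
       (\<Sum>k<j. cnt ?E (Suc (Suc n)) d k) else 0)"
     "cnt ?E (Suc (Suc (Suc n))) d j = (if 0 < j \<and> j < Suc (Suc (Suc n)) then
       (\<Sum>k=j..<Suc (Suc n). cnt ?E (Suc (Suc n)) d k) else 0)" for n j
    using cd by (subst cnt_step; simp add: sum_colour[OF cd] del: sum.op_ivl_Suc sum.lessThan_Suc)+
  have d: "cnt ?E (Suc (Suc n)) d j = (if j = 1 then 1 else 0)" for n j
  proof (induction n arbitrary: j)
    case (Suc n)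
    show ?case unfolding step(2)[of n] Suc
      by (auto simp: sum_delta_ivl simp del: sum.op_ivl_Suc)
  qed (simp add: cnt_2_Suc)
  have c: "cnt ?E (Suc (Suc (Suc n))) c j = (if 1 < j \<and> j \<le> n + 2 then 1 else 0)" for n j
    unfolding step(1) d by (auto simp: sum_delta_less simp del: sum.lessThan_Suc)
  have sc: "(\<Sum>k < Suc (Suc (Suc n)). cnt ?E (Suc (Suc (Suc n))) c k) = n + 1" for n
    unfolding c by (subst sum_count) auto
  show ?thesis
  proof (rule tot_lin_seqI)
    show "(\<Sum>y \<in> UNIV. \<Sum>k < Suc (Suc (Suc n)). cnt ?E (Suc (Suc (Suc n))) y k) = n + 2" for n
      by (simp add: sum_colour[OF cd] sc d sum_delta_less del: sum.lessThan_Suc)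
  qed
qed

text \<open>The chain of colour \<open>d\<close> now runs to the right. Its rank is again 1, so the
  count agrees with that of \<open>tot_lin_4\<close>.\<close>

lemma tot_lin_5: "tot {(L12, c, d), (R23, d, d)} = lin_seq"
proof -
  let ?E = "{(L12, c, d), (R23, d, d)}"
  have step: "cnt ?E (Suc (Suc (Suc n))) c j = (if 0 < j \<and> j < Suc (Suc (Suc n)) then
       (\<Sum>k<j. cnt ?E (Suc (Suc n)) d k) else 0)" for n j
    using cd by (subst cnt_step) (simp_all add: sum_colour[OF cd] del: sum.op_ivl_Suc sum.lessThan_Suc)
  have d: "cnt ?E (Suc (Suc n)) d j = (if j = 1 then 1 else 0)" for n j
  proof (induction n arbitrary: j)
    case (Suc n)
    have "cntr ?E (Suc (Suc n)) d = (\<Sum>k<Suc (Suc n). cnt ?E (Suc (Suc n)) d k)"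
      using cd by (subst cntr_ge_2) (simp_all add: sum_colour[OF cd] del: sum.lessThan_Suc)
    also have "\<dots> = 1" by (simp add: Suc sum_delta_less del: sum.lessThan_Suc)
    finally show ?case using cd by (subst cnt_no_L) simp_all
  qed (simp add: cnt_2_Suc)
  have c: "cnt ?E (Suc (Suc (Suc n))) c j = (if 1 < j \<and> j \<le> n + 2 then 1 else 0)" for n j
    unfolding step(1) d by (auto simp: sum_delta_less simp del: sum.lessThan_Suc)
  have sc: "(\<Sum>k < Suc (Suc (Suc n)). cnt ?E (Suc (Suc (Suc n))) c k) = n + 1" for n
    unfolding c by (subst sum_count) auto
  show ?thesis
  proof (rule tot_lin_seqI)
    show "(\<Sum>y \<in> UNIV. \<Sum>k < Suc (Suc (Suc n)). cnt ?E (Suc (Suc (Suc n))) y k) = n + 2" for n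
      by (simp add: sum_colour[OF cd] sc d sum_delta_less del: sum.lessThan_Suc)
  qed
qed

end

text \<open>Involutions of \<open>n\<close> points: the last point is fixed or exchanged with one of
  the others.\<close>

fun invol :: "nat \<Rightarrow> nat" where
  "invol 0 = 1"
| "invol (Suc 0) = 1"
| "invol (Suc (Suc n)) = invol (Suc n) + Suc n * invol n"

definition invol_seq :: "nat \<Rightarrow> nat" where
  "invol_seq n = (if n \<le> 2 then n else invol (n - 1))"

definition fact_seq :: "nat \<Rightarrow> nat" where
  "fact_seq n = (if n \<le> 2 then n else fact (n - 1))"

text \<open>The right subtree has one or two leaves. In the second case its other label is any of
  the \<open>n - 1 - j\<close> labels above the right minimum.\<close>

lemma cnt_cherry:
  assumes "\<And>m. cntr E m c = of_bool (m = 1 \<or> m = 2)" "0 < j" "j < n"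
  shows "cnt E n c j = cntl E (n - 1) c j + (n - 1 - j) * cntl E (n - 2) c j"
proof (cases "n - 1 - j")
  case 0
  then have "j = n - 1" using assms(3) by simp
  then show ?thesis using assms 0 by (simp add: cnt_rec)
next
  case (Suc b)
  have n: "n = j + b + 2" using Suc by simp
  let ?f = "\<lambda>i. (Suc b choose i) * cntl E (j + i) c j * cntr E (n - j - i) c"
  have "cnt E n c j = (\<Sum>i\<le>Suc b. ?f i)" using cnt_rec[OF assms(2,3), of E c] Suc by simp
  also have "\<dots> = ?f (Suc b) + (?f b + (\<Sum>i<b. ?f i))"
    by (simp only: atMost_Suc_eq_insert_0 sum.atMost_Suc lessThan_Suc_atMost[symmetric] sum.lessThan_Suc)
  also have "(\<Sum>i<b. ?f i) = 0" using assms(1) n by (intro sum.neutral) auto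
  finally show ?thesis using n assms(1) by simp
qed

lemma tot_main:
  fixes E :: "colour edge set"
  assumes "c \<noteq> d" "\<And>t y. (t, d, y) \<notin> E"
    and "\<And>n. (\<Sum>k < Suc (Suc (Suc n)). cnt E (Suc (Suc (Suc n))) c k) = s (Suc (Suc (Suc n)))"
    and "s 0 = 0" "s 1 = 1" "s 2 = 2"
  shows "tot E = s"
proof (rule nat_seq_eqI3)
  fix n
  have "cnt E (Suc (Suc (Suc n))) d k = 0" for k
    using assms(2) by (subst cnt_no_child) auto
  then show "tot E (Suc (Suc (Suc n))) = s (Suc (Suc (Suc n)))"
    using tot_ge_2[of "Suc (Suc (Suc n))" E] assms(3)[of n]
    by (simp add: sum_colour[OF assms(1)] del: sum.lessThan_Suc)
qed (use assms in \<open>simp_all add: tot_2\<close>)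

text \<open>Involutions of \<open>r\<close> ordinary and \<open>p\<close> extra points in which
  every extra point is exchanged with an ordinary one.\<close>

definition partial_invol :: "nat \<Rightarrow> nat \<Rightarrow> nat" where
  "partial_invol r p = (r choose p) * fact p * invol (r - p)"

text \<open>The summands follow the last ordinary point: exchanged with another ordinary point, for
  which it acts as a further extra point; fixed; or exchanged with one of the \<open>p\<close> extra
  points.\<close>

lemma partial_invol_Suc:
  "partial_invol (Suc r) p = partial_invol r (Suc p) + partial_invol r p + p * partial_invol r (p - 1)"
proof -
  \<comment> \<open>These are the involutions in which the last ordinary point is not exchanged with
    an extra one.\<close>
  have A: "(r choose p) * fact p * invol (Suc r - p) = partial_invol r (Suc p) + partial_invol r p"
  proof (cases "p < r")
    case True
    then obtain q where q: "r - p = Suc q" using not0_implies_Suc[of "r - p"] by auto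
    have eq: "(r choose Suc p) * Suc p = (r choose p) * (r - p)"
      using binomial_absorb_comp[of r p] choose_reduce_nat
      by (metis Suc_times_binomial_eq binomial_absorption mult.commute times_binomial_minus1_eq)
    have "partial_invol r (Suc p) = ((r choose Suc p) * Suc p) * fact p * invol (r - Suc p)"
      by (simp only: partial_invol_def fact_Suc of_nat_id mult.assoc)
    then have "partial_invol r (Suc p) = ((r choose p) * (r - p)) * fact p * invol (r - Suc p)"
      by (simp only: eq)
    moreover have "invol (Suc r - p) = invol (r - p) + (r - p) * invol (r - Suc p)"
    proof -
      have "Suc r - p = Suc (Suc q)" "r - Suc p = q" using q by simp_all
      then show ?thesis using q by simp
    qed
    ultimately show ?thesis by (simp add: partial_invol_def algebra_simps)
  next
    case False
    then show ?thesis by (cases "p = r") (auto simp: partial_invol_def Suc_diff_le)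
  qed
  show ?thesis
  proof (cases p)
    case 0
    then show ?thesis using A by (simp add: partial_invol_def)
  next
    case (Suc q)
    have "partial_invol (Suc r) p = (r choose p) * fact p * invol (Suc r - p) + p * partial_invol r q"
      unfolding Suc by (simp add: partial_invol_def algebra_simps)
    then show ?thesis using A Suc by simp
  qed
qed

section \<open>Pairs of edges giving involution numbers and factorials\<close>

context
  fixes c d :: colour
  assumes cd: "c \<noteq> d"
begin

text \<open>The right subtree is a leaf or a cherry of colour \<open>d\<close>, as \<open>d\<close>
  has no internal child.\<close>

lemma cntr_cherry:
  assumes E: "E = {(t, c, c), (R23, c, d)}" "t \<noteq> R23"
  shows "cntr E m c = of_bool (m = 1 \<or> m = 2)"
proof -
  have d: "cnt E n d j = of_bool (n = 2 \<and> j = 1)" if "n \<ge> 2" for n j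
    using that cd E by (intro cnt_no_child) auto
  consider "m = 0" | "m = 1" | "m = 2" | "m \<ge> 3" by linarith
  then show ?thesis
  proof cases
    case 1
    then show ?thesis by (simp add: cntr_def)
  next
    case 3
    then show ?thesis using E cd
      by (simp add: cntr_ge_2 sum_colour[OF cd] numeral_2_eq_2 cnt_2_Suc)
  next
    case 4
    then show ?thesis using E cd
      by (simp add: cntr_ge_2 sum_colour[OF cd] d[unfolded E(1)])
  qed simp
qed

text \<open>Kind \<open>L13\<close> above a left child of rank 1 forces rank 1 again, so
  \<open>cnt_cherry\<close> turns into the recursion of \<open>invol\<close>.\<close>

lemma tot_invol_1: "tot {(L13, c, c), (R23, c, d)} = invol_seq"
proof -
  let ?E = "{(L13, c, c), (R23, c, d)}"
  have rec: "cnt ?E n c j = cntl ?E (n - 1) c j + (n - 1 - j) * cntl ?E (n - 2) c j" if "0 < j" "j < n" for n j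
    using that by (intro cnt_cherry cntr_cherry) auto
  have l: "cntl ?E m c j = (\<Sum>k=j..<m. cnt ?E m c k)" if "m \<ge> 2" "j \<le> m" for m j
    using that cd by (subst cntl_split) (simp_all add: sum_colour[OF cd])
  have c: "cnt ?E n c j = (if j = 1 then invol (n - 1) else 0)" if "n \<ge> 2" for n j
    using that
  proof (induction n arbitrary: j rule: less_induct)
    case (less n)
    have l': "cntl ?E m c j = (if j = 1 then invol (m - 1) else 0)"
      if "0 < m" "m < n" "0 < j" "j \<le> m" for m j
    proof (cases "m = 1")
      case False
      then have "cntl ?E m c j = (\<Sum>k=j..<m. if k = 1 then invol (m - 1) else 0)"
        using that less.IH[of m] by (simp add: l)
      then show ?thesis using that False by (auto simp: sum_delta_ivl)
    qed (use that in simp)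
    show ?case
    proof (cases "0 < j \<and> j < n")
      case True
      show ?thesis
      proof (cases "n = 2")
        case True
        then show ?thesis by (simp add: cnt_2)
      next
        case False
        then obtain k where k: "n = Suc (Suc (Suc k))"
          using less.prems by (metis One_nat_def numeral_2_eq_2 not0_implies_Suc not_less_eq_eq le0)
        have "cnt ?E n c j = cntl ?E (Suc (Suc k)) c j + (Suc (Suc k) - j) * cntl ?E (Suc k) c j"
          using rec[of j n] True k by simp
        also have "cntl ?E (Suc (Suc k)) c j = (if j = 1 then invol (Suc k) else 0)"
          using l'[of "Suc (Suc k)" j] True k by simp
        also have "(Suc (Suc k) - j) * cntl ?E (Suc k) c j = (Suc (Suc k) - j) * (if j = 1 then invol k else 0)"
          using True k l'[of "Suc k" j] by (cases "j = Suc (Suc k)") auto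
        finally show ?thesis using k by simp
      qed
    next
      case False
      then show ?thesis using less.prems by auto
    qed
  qed
  show ?thesis
    by (rule tot_main[OF cd]) (use cd in \<open>auto simp: c sum_delta_less invol_seq_def simp del: sum.lessThan_Suc\<close>)
qed

text \<open>Here the left subtree is a leaf or a cherry of colour \<open>d\<close>, and the rank is
  1 in both cases. Choosing the second label of the cherry gives the factor in the recursion of
  \<open>invol\<close>.\<close>

lemma tot_invol_2: "tot {(L13, c, d), (R23, c, c)} = invol_seq"
proof -
  let ?E = "{(L13, c, d), (R23, c, c)}"
  have d: "cnt ?E n d j = of_bool (n = 2 \<and> j = 1)" if "n \<ge> 2" for n j
    using that cd by (intro cnt_no_child) auto
  have l: "cntl ?E m c j = of_bool (j = 1 \<and> m \<le> 2)" if jm: "0 < j" "j \<le> m" for m j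
  proof -
    consider "m = 1" | "m = 2" | "m \<ge> 3" using jm by linarith
    then show ?thesis
    proof cases
      case 1
      then show ?thesis using that by simp
    next
      case 2
      then have "j = 1 \<or> j = 2" using that by auto
      then show ?thesis using 2 cd
        by (auto simp: cntl_split sum_colour[OF cd] d numeral_2_eq_2 cnt_2_Suc)
    next
      case 3
      then show ?thesis using that cd
        by (simp add: cntl_split sum_colour[OF cd] d)
    qed
  qed
  have c: "cnt ?E n c j = (if j = 1 then invol (n - 1) else 0)" if "n \<ge> 2" for n j
    using that
  proof (induction n arbitrary: j rule: less_induct)
    case (less n)
    have r: "cntr ?E m c = invol (m - 1)" if "0 < m" "m < n" for m
    proof (cases "m = 1")
      case False
      then have "cntr ?E m c = (\<Sum>k<m. if k = 1 then invol (m - 1) else 0)"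
        using that cd less.IH[of m] by (simp add: cntr_ge_2 sum_colour[OF cd])
      then show ?thesis using that False by (simp add: sum_delta_less)
    qed (use that in simp)
    show ?case
    proof (cases "0 < j \<and> j < n")
      case True
      then have rec: "cnt ?E n c j = (\<Sum>i\<le>n - 1 - j. (n - 1 - j choose i) * of_bool (j = 1 \<and> i \<le> 1) * cntr ?E (n - j - i) c)"
        by (subst cnt_rec) (auto simp: l intro!: sum.cong)
      show ?thesis
      proof (cases "j = 1")
        case j: True
        show ?thesis
        proof (cases "n = 2")
          case True
          then show ?thesis using j by (simp add: cnt_2)
        next
          case False
          then obtain k where k: "n = Suc (Suc (Suc k))"
            using less.prems by (metis One_nat_def numeral_2_eq_2 not0_implies_Suc not_less_eq_eq le0)
          have "cnt ?E n c j = (\<Sum>i\<le>Suc k. if i \<le> 1 then (Suc k choose i) * cntr ?E (Suc (Suc k) - i) c else 0)"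
            unfolding rec using j k by (auto intro!: sum.cong)
          also have "\<dots> = (\<Sum>i\<in>{0, 1}. (Suc k choose i) * cntr ?E (Suc (Suc k) - i) c)"
            by (rule sum.mono_neutral_cong_right) auto
          also have "\<dots> = cntr ?E (Suc (Suc k)) c + Suc k * cntr ?E (Suc k) c" by simp
          finally show ?thesis using j k r[of "Suc k"] r[of "Suc (Suc k)"] by simp
        qed
      next
        case False
        then show ?thesis using rec by simp
      qed
    next
      case False
      then show ?thesis using less.prems by auto
    qed
  qed
  show ?thesis
    by (rule tot_main[OF cd]) (use cd in \<open>auto simp: c sum_delta_less invol_seq_def simp del: sum.lessThan_Suc\<close>)
qed

text \<open>Ranks vary here, so the induction needs a refinement: \<open>r\<close> non-minimal
  labels of the left subtree lie below the sibling's minimum and \<open>p\<close> above it. Raising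
  the bound on the rank by one reproduces \<open>partial_invol_Suc\<close>; the total is the case
  \<open>p = 0\<close>.\<close>

lemma tot_invol_3: "tot {(L12, c, c), (R23, c, d)} = invol_seq"
proof -
  let ?E = "{(L12, c, c), (R23, c, d)}"
  have rec: "cnt ?E n c j = cntl ?E (n - 1) c j + (n - 1 - j) * cntl ?E (n - 2) c j" if "0 < j" "j < n" for n j
    using that by (intro cnt_cherry cntr_cherry) auto
  have l: "cntl ?E m c j = (\<Sum>k<j. cnt ?E m c k)" if "m \<ge> 2" "j \<le> m" for m j
    using that cd by (subst cntl_split) (simp_all add: sum_colour[OF cd])
  have c: "cntl ?E (Suc (r + p)) c (Suc r) = partial_invol r p" for r p
  proof (induction r arbitrary: p)
    case 0
    show ?case by (cases p) (simp_all add: l partial_invol_def)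
  next
    case (Suc r)
    let ?m = "Suc (Suc (r + p))"
    have "cntl ?E ?m c (Suc (Suc r)) = (\<Sum>k<Suc r. cnt ?E ?m c k) + cnt ?E ?m c (Suc r)"
      by (simp add: l)
    also have "(\<Sum>k<Suc r. cnt ?E ?m c k) = partial_invol r (Suc p)"
      using Suc[of "Suc p"] l[of ?m "Suc r"] by simp
    also have "cnt ?E ?m c (Suc r) = cntl ?E (Suc (r + p)) c (Suc r) + p * cntl ?E (r + p) c (Suc r)"
      using rec[of "Suc r" ?m] by simp
    also have "p * cntl ?E (r + p) c (Suc r) = p * partial_invol r (p - 1)"
      using Suc[of "p - 1"] by (cases p) simp_all
    finally show ?case by (simp add: partial_invol_Suc Suc)
  qed
  have "(\<Sum>k<Suc (Suc (Suc n)). cnt ?E (Suc (Suc (Suc n))) c k) = invol_seq (Suc (Suc (Suc n)))" for n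
    using c[of "Suc (Suc n)" 0] l[of "Suc (Suc (Suc n))" "Suc (Suc (Suc n))"]
    by (simp add: partial_invol_def invol_seq_def del: sum.lessThan_Suc)
  then show ?thesis
    by (intro tot_main[OF cd]) (use cd in \<open>auto simp: invol_seq_def simp del: sum.lessThan_Suc\<close>)
qed

text \<open>Together \<open>L12\<close> and \<open>L13\<close> put no condition on ranks, so each
  vertex added on top of a chain may have its right leaf at any rank.\<close>

lemma tot_fact_1: "tot {(L12, c, c), (L13, c, c)} = fact_seq"
proof -
  let ?E = "{(L12, c, c), (L13, c, c)}"
  have step: "cnt ?E (Suc (Suc (Suc n))) c j = (if 0 < j \<and> j < Suc (Suc (Suc n)) then
     (\<Sum>k<Suc (Suc n). cnt ?E (Suc (Suc n)) c k) else 0)" for n j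
  proof -
    have "(\<Sum>k<j. f k) + (\<Sum>k=j..<Suc (Suc n). f k) = (\<Sum>k<Suc (Suc n). f k)"
      if "j < Suc (Suc (Suc n))" for f :: "nat \<Rightarrow> nat"
      unfolding lessThan_atLeast0 using that by (intro sum.atLeastLessThan_concat) auto
    then show ?thesis
      using cd by (subst cnt_step) (simp_all add: sum_colour[OF cd] del: sum.op_ivl_Suc sum.lessThan_Suc)
  qed
  have c: "cnt ?E (Suc (Suc n)) c j = fact n * (if 0 < j \<and> j \<le> n + 1 then 1 else 0)" for n j
  proof (induction n arbitrary: j)
    case (Suc n)
    have "(\<Sum>k<Suc (Suc n). cnt ?E (Suc (Suc n)) c k) = fact (Suc n)"
      unfolding Suc sum_distrib_left[symmetric] by (subst sum_count) auto
    then show ?case unfolding step[of n] by auto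
  qed (auto simp: cnt_2_Suc)
  have "(\<Sum>k<Suc (Suc (Suc n)). cnt ?E (Suc (Suc (Suc n))) c k) = fact_seq (Suc (Suc (Suc n)))" for n
    unfolding c sum_distrib_left[symmetric] by (subst sum_count) (auto simp: fact_seq_def)
  then show ?thesis
    by (intro tot_main[OF cd]) (use cd in \<open>auto simp: fact_seq_def simp del: sum.lessThan_Suc\<close>)
qed

text \<open>The induction works because the rank of the root is uniformly distributed over its
  \<open>n - 1\<close> values.\<close>

lemma tot_fact_2: "tot {(L12, c, c), (R23, c, c)} = fact_seq"
proof -
  let ?E = "{(L12, c, c), (R23, c, c)}"
  have l: "cntl ?E m c j = (\<Sum>k<j. cnt ?E m c k)" if "m \<ge> 2" "j \<le> m" for m j
    using that cd by (subst cntl_split) (simp_all add: sum_colour[OF cd])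
  have c: "cnt ?E n c j = fact (n - 2) * (if 0 < j \<and> j \<le> n - 1 then 1 else 0)" if "n \<ge> 2" for n j
    using that
  proof (induction n arbitrary: j rule: less_induct)
    case (less n)
    have r: "cntr ?E m c = fact (m - 1)" if "0 < m" "m < n" for m
    proof (cases "m = 1")
      case False
      then have "cntr ?E m c = (\<Sum>k<m. cnt ?E m c k)"
        using that cd by (simp add: cntr_ge_2 sum_colour[OF cd])
      also have "\<dots> = (\<Sum>k<m. fact (m - 2) * (if 0 < k \<and> k \<le> m - 1 then 1 else 0))"
        using that False less.IH[of m] by (intro sum.cong) auto
      also have "\<dots> = fact (m - 2) * (m - 1)"
        unfolding sum_distrib_left[symmetric] using that by (subst sum_count) auto
      also have "\<dots> = fact (m - 1)"
        using that False fact_reduce[of "m - 1", where 'a = nat] by (simp add: numeral_2_eq_2)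
      finally show ?thesis .
    qed (use that in simp)
    have l': "cntl ?E m c j = fact (m - 2) * (j - 1)" if "2 \<le> m" "m < n" "j \<le> m" for m j
    proof -
      have "cntl ?E m c j = (\<Sum>k<j. fact (m - 2) * (if 0 < k \<and> k \<le> j - 1 then 1 else 0))"
        unfolding l[OF that(1,3)] using that less.IH[of m] by (intro sum.cong) auto
      also have "\<dots> = fact (m - 2) * (j - 1)"
        unfolding sum_distrib_left[symmetric] by (cases "j = 0") (simp, subst sum_count, auto)
      finally show ?thesis .
    qed
    show ?case
    proof (cases "0 < j \<and> j < n")
      case True
      define a where "a = n - 1 - j"
      have n: "n = a + j + 1" using True by (simp add: a_def)
      have rec: "cnt ?E n c j = (\<Sum>i\<le>a. (a choose i) * cntl ?E (j + i) c j * cntr ?E (n - j - i) c)"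
        unfolding a_def using True by (intro cnt_rec) auto
      have "cnt ?E n c j = fact (n - 2)"
      proof (cases "j = 1")
        case j: True
        \<comment> \<open>For \<open>j = 1\<close> kind \<open>L12\<close> would need a left child
          of rank 0, so the left subtree is a leaf and \<open>i = 0\<close>.\<close>
        have "cnt ?E n c j = (\<Sum>i\<le>a. if i = 0 then fact (n - 2) else 0)"
          unfolding rec
        proof (intro sum.cong refl)
          fix i assume "i \<in> {..a}"
          then show "(a choose i) * cntl ?E (j + i) c j * cntr ?E (n - j - i) c = (if i = 0 then fact (n - 2) else 0)"
            using j n l'[of "Suc i" 1] r[of "n - 1"] by (cases "i = 0") auto
        qed
        then show ?thesis by simp
      next
        case False
        then obtain q where q: "j = Suc (Suc q)" using True by (metis One_nat_def not0_implies_Suc less_not_refl)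
        \<comment> \<open>After cancelling factorials only the last binomial depends on
          \<open>i\<close>, and the sum is evaluated by the hockey-stick identity.\<close>
        have "cnt ?E n c j = (\<Sum>i\<le>a. fact a * (j - 1) * fact q * ((q + i) choose i))"
          unfolding rec
        proof (intro sum.cong refl)
          fix i assume i: "i \<in> {..a}"
          have l'': "cntl ?E (j + i) c j = fact (q + i) * (j - 1)" using l'[of "j + i" j] i n q by simp
          have r': "cntr ?E (n - j - i) c = fact (a - i)" using r[of "n - j - i"] i n True by simp
          have a: "(a choose i) * fact i * fact (a - i) = (fact a :: nat)" using i binomial_fact_lemma[of i a] by (simp add: mult_ac)
          have q: "((q + i) choose i) * fact i * fact q = (fact (q + i) :: nat)" using binomial_fact_lemma[of i "q + i"] by (simp add: mult_ac)
          show "(a choose i) * cntl ?E (j + i) c j * cntr ?E (n - j - i) c =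
              fact a * (j - 1) * fact q * ((q + i) choose i)"
            unfolding l'' r' a[symmetric] q[symmetric] by (simp only: mult_ac)
        qed
        also have "\<dots> = fact a * (j - 1) * fact q * (Suc (q + a) choose a)"
          by (simp only: sum_distrib_left[symmetric] sum_choose_lower)
        also have "\<dots> = fact a * fact (Suc q) * (Suc (q + a) choose a)"
          unfolding q by (simp add: algebra_simps)
        also have "\<dots> = fact (Suc (q + a))"
          using binomial_fact_lemma[of a "Suc (q + a)"] by (simp add: Suc_diff_le del: fact_Suc)
        also have "Suc (q + a) = n - 2" using q n by simp
        finally show ?thesis .
      qed
      moreover have "j \<le> n - 1" using True by linarith
      ultimately show ?thesis using True by simp
    next
      case False
      then show ?thesis using less.prems by auto
    qed
  qed
  have "(\<Sum>k<Suc (Suc (Suc n)). cnt ?E (Suc (Suc (Suc n))) c k) = fact_seq (Suc (Suc (Suc n)))" for n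
  proof -
    have "(\<Sum>k<Suc (Suc (Suc n)). cnt ?E (Suc (Suc (Suc n))) c k) =
      (\<Sum>k<Suc (Suc (Suc n)). fact (Suc n) * (if 0 < k \<and> k \<le> Suc (Suc n) then 1 else 0))"
      by (intro sum.cong refl) (simp add: c)
    also have "\<dots> = fact (Suc n) * Suc (Suc n)"
      unfolding sum_distrib_left[symmetric] by (subst sum_count) auto
    finally show ?thesis by (simp add: fact_seq_def)
  qed
  then show ?thesis
    by (intro tot_main[OF cd]) (use cd in \<open>auto simp: fact_seq_def simp del: sum.lessThan_Suc\<close>)
qed

text \<open>All ranks are 1, and each of the \<open>n - 1\<close> possible sizes of the left subtree
  contributes the same number of trees, the factorial of \<open>n - 2\<close>.\<close>

lemma tot_fact_3: "tot {(L13, c, c), (R23, c, c)} = fact_seq"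
proof -
  let ?E = "{(L13, c, c), (R23, c, c)}"
  have l: "cntl ?E m c j = (\<Sum>k=j..<m. cnt ?E m c k)" if "m \<ge> 2" "j \<le> m" for m j
    using that cd by (subst cntl_split) (simp_all add: sum_colour[OF cd])
  have c: "cnt ?E n c j = (if j = 1 then fact (n - 1) else 0)" if "n \<ge> 2" for n j
    using that
  proof (induction n arbitrary: j rule: less_induct)
    case (less n)
    have r: "cntr ?E m c = fact (m - 1)" if "0 < m" "m < n" for m
    proof (cases "m = 1")
      case False
      then have "cntr ?E m c = (\<Sum>k<m. if k = 1 then fact (m - 1) else 0)"
        using that cd less.IH[of m] by (simp add: cntr_ge_2 sum_colour[OF cd])
      then show ?thesis using that False by (simp add: sum_delta_less)
    qed (use that in simp)
    have l': "cntl ?E m c j = (if j = 1 then fact (m - 1) else 0)"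
      if "0 < m" "m < n" "0 < j" "j \<le> m" for m j
    proof (cases "m = 1")
      case False
      then have "cntl ?E m c j = (\<Sum>k=j..<m. if k = 1 then fact (m - 1) else 0)"
        using that less.IH[of m] by (simp add: l)
      then show ?thesis using that False by (auto simp: sum_delta_ivl)
    qed (use that in simp)
    show ?case
    proof (cases "0 < j \<and> j < n")
      case True
      define a where "a = n - 1 - j"
      have n: "n = a + j + 1" using True by (simp add: a_def)
      have "cnt ?E n c j = (\<Sum>i\<le>a. (a choose i) * cntl ?E (j + i) c j * cntr ?E (n - j - i) c)"
        unfolding a_def using True by (intro cnt_rec) auto
      also have "\<dots> = (\<Sum>i\<le>a. if j = 1 then fact a else 0)"
      proof (intro sum.cong refl)
        fix i assume i: "i \<in> {..a}"
        have "(a choose i) * fact i * fact (a - i) = (fact a :: nat)" using i binomial_fact_lemma[of i a] by (simp add: mult_ac)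
        then show "(a choose i) * cntl ?E (j + i) c j * cntr ?E (n - j - i) c = (if j = 1 then fact a else 0)"
          using True n i l'[of "j + i" j] r[of "n - j - i"] by simp
      qed
      also have "\<dots> = (if j = 1 then fact (n - 1) else 0)"
        using n by simp
      finally show ?thesis .
    next
      case False
      then show ?thesis using less.prems by auto
    qed
  qed
  show ?thesis
    by (rule tot_main[OF cd]) (use cd in \<open>auto simp: c sum_delta_less fact_seq_def simp del: sum.lessThan_Suc\<close>)
qed

end

subsection \<open>Counting the classes\<close>

definition recolour :: "('x \<Rightarrow> 'x) \<Rightarrow> 'x edge set \<Rightarrow> 'x edge set" where
  "recolour f E = (\<lambda>(t, x, y). (t, f x, f y)) ` E"

lemma tot_recolour:
  fixes E :: "'x::finite edge set"
  assumes "bij f"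
  shows "tot (recolour f E) = tot E"
proof -
  have inj: "f x = f y \<longleftrightarrow> x = y" for x y using assms by (simp add: bij_is_inj inj_eq)
  have mem: "(t, f x, f y) \<in> recolour f E \<longleftrightarrow> (t, x, y) \<in> E" for t x y
    by (force simp: recolour_def inj image_iff)
  have reindex: "(\<Sum>y \<in> UNIV. g y) = (\<Sum>y \<in> UNIV. g (f y))" for g :: "'x \<Rightarrow> nat"
    using sum.reindex_bij_betw[OF assms, of g] by simp
  have cnt: "cnt (recolour f E) n (f c) j = cnt E n c j" for n c j
  proof (induction n arbitrary: c j rule: less_induct)
    case (less n)
    show ?case
    proof (cases "0 < j \<and> j < n")
      case True
      have l: "cntl (recolour f E) m (f c) j = cntl E m c j" if "m < n" for m
        unfolding cntl_def by (subst reindex) (simp only: mem less[OF that])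
      have r: "cntr (recolour f E) m (f c) = cntr E m c" if "m < n" for m
        unfolding cntr_def by (subst reindex) (simp only: mem less[OF that])
      show ?thesis
        using True by (subst (1 2) cnt_rec) (auto intro!: sum.cong simp: l r)
    next
      case False
      then show ?thesis by auto
    qed
  qed
  show ?thesis
  proof
    show "tot (recolour f E) n = tot E n" for n
      unfolding tot_def by (subst reindex) (intro arg_cong2[of _ _ _ _ "(+)"] sum.cong refl cnt)
  qed
qed

fun other :: "colour \<Rightarrow> colour" where
  "other White = Black"
| "other Black = White"

lemma bij_other: "bij other"
proof (rule o_bij[of other])
  have "other (other x) = x" for x by (cases x) simp_all
  then show "other \<circ> other = id" "other \<circ> other = id" by (simp_all add: fun_eq_iff)
qed

lemma tot_other:
  "tot {(t, c, d), (t', c', d')} = tot {(t, other c, other d), (t', other c', other d')}"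
  using tot_recolour[OF bij_other, of "{(t, c, d), (t', c', d')}"] by (simp add: recolour_def)


text \<open>Normal forms for the colour patterns that have no closed form, matching the entries of
  \<open>pair_seqs\<close>.\<close>

lemma tot_swap:
  fixes c d :: colour
  assumes "c \<noteq> d"
  shows "tot {(t, c, d), (t', c, d)} = tot {(t, White, Black), (t', White, Black)}"
    and "tot {(t, c, d), (t', d, c)} = tot {(t, White, Black), (t', Black, White)}"
    and "tot {(t, c, d), (t', c, c)} = tot {(t, White, Black), (t', White, White)}"
  using assms tot_other[of t c d t' c d] tot_other[of t c d t' d c] tot_other[of t c d t' c c]
  by (cases c; cases d; simp)+

text \<open>Index 6 is needed to separate sequences that agree at 4 and 5: two of the ten have the
  values 3, 5 there, and two have 4, 10.\<close>

definition sample :: "(nat \<Rightarrow> nat) \<Rightarrow> nat \<times> nat \<times> nat" where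
  "sample f = (f 4, f 5, f 6)"

lemma sample_closed:
  "sample two_seq = (2, 2, 2)" "sample lin_seq = (3, 4, 5)"
  "sample invol_seq = (4, 10, 26)" "sample fact_seq = (6, 24, 120)"
  by (simp_all add: sample_def two_seq_def lin_seq_def invol_seq_def fact_seq_def numeral_eq_Suc)

lemma sample_L12_L13: "sample (tot {(L12, White, Black), (L13, White, Black)}) = (0, 0, 0)"
  by (simp add: sample_def tot_def cnt.simps UNIV_colour[of White Black] numeral_eq_Suc)

lemma sample_L12_R23: "sample (tot {(L12, White, Black), (R23, White, Black)}) = (1, 0, 0)"
  by (simp add: sample_def tot_def cnt.simps UNIV_colour[of White Black] numeral_eq_Suc)

lemma sample_L13_R23: "sample (tot {(L13, White, Black), (R23, White, Black)}) = (2, 0, 0)"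
  by (simp add: sample_def tot_def cnt.simps UNIV_colour[of White Black] numeral_eq_Suc)

lemma sample_fib: "sample (tot {(L12, White, Black), (R23, White, White)}) = (3, 5, 8)"
  by (simp add: sample_def tot_def cnt.simps UNIV_colour[of White Black] numeral_eq_Suc)

lemma sample_L12_R23_alt: "sample (tot {(L12, White, Black), (R23, Black, White)}) = (3, 5, 11)"
  by (simp add: sample_def tot_def cnt.simps UNIV_colour[of White Black] numeral_eq_Suc)

lemma sample_L12_L13_alt: "sample (tot {(L12, White, Black), (L13, Black, White)}) = (4, 10, 32)"
  by (simp add: sample_def tot_def cnt.simps UNIV_colour[of White Black] numeral_eq_Suc)

definition pair_seqs :: "(nat \<Rightarrow> nat) list" where
  "pair_seqs = [two_seq, lin_seq, invol_seq, fact_seq,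
     tot {(L12, White, Black), (L13, White, Black)},
     tot {(L12, White, Black), (R23, White, Black)},
     tot {(L13, White, Black), (R23, White, Black)},
     tot {(L12, White, Black), (R23, White, White)},
     tot {(L12, White, Black), (R23, Black, White)},
     tot {(L12, White, Black), (L13, Black, White)}]"

text \<open>Ten different samples bound the number from below, the length of the list from
  above.\<close>

lemma card_pair_seqs: "card (set pair_seqs) = 10"
proof -
  have "card (sample ` set pair_seqs) = 10"
    by (simp add: pair_seqs_def sample_closed sample_L12_L13 sample_L12_R23 sample_L13_R23
        sample_fib sample_L12_R23_alt sample_L12_L13_alt)
  moreover have "card (sample ` set pair_seqs) \<le> card (set pair_seqs)"
    by (rule card_image_le) simp
  moreover have "card (set pair_seqs) \<le> 10"
    using card_length[of pair_seqs] by (simp add: pair_seqs_def)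
  ultimately show ?thesis by linarith
qed

text \<open>Naming the colours relative to the source \<open>a\<close> of the first edge leaves
  eight patterns for each pair of kinds; each has a closed form or is normalised by
  \<open>tot_swap\<close>.\<close>

lemma tot_pair_ordered:
  fixes a b a' b' :: colour
  assumes "t \<noteq> t'" "(t, t') \<in> {(L12, L13), (L12, R23), (L13, R23)}"
  shows "tot {(t, a, b), (t', a', b')} \<in> set pair_seqs"
proof -
  obtain d where ad: "a \<noteq> d" by (cases a) auto
  have cases: "b = a \<or> b = d" "a' = a \<or> a' = d" "b' = a \<or> b' = d"
    using colour_cases[OF ad] by blast+
  note two = tot_L12_L13_two[OF ad] tot_L12_R23_two[OF ad] tot_L13_R23_two[OF ad]
  note lin = tot_lin_1[OF ad] tot_lin_2[OF ad] tot_lin_3[OF ad]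
    tot_lin_4[OF ad] tot_lin_5[OF ad]
  note inv = tot_invol_1[OF ad] tot_invol_2[OF ad] tot_invol_3[OF ad]
  note fac = tot_fact_1[OF ad] tot_fact_2[OF ad] tot_fact_3[OF ad]
  \<comment> \<open>The third rule is instantiated at \<open>L12\<close>, \<open>R23\<close> only,
    because for the other pairs of kinds this colour pattern has a closed form.\<close>
  note swap = tot_swap(1,2)[OF ad] tot_swap(3)[OF ad, of L12 R23]
  consider "t = L12" "t' = L13" | "t = L12" "t' = R23" | "t = L13" "t' = R23"
    using assms(2) by blast
  then show ?thesis
  proof cases
    case 1
    show ?thesis using cases
      by (elim disjE) (simp_all only: 1 two lin inv fac swap pair_seqs_def list.set insert_iff simp_thms)
  next
    case 2
    show ?thesis using cases
      by (elim disjE) (simp_all only: 2 two lin inv fac swap pair_seqs_def list.set insert_iff simp_thms)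
  next
    case 3
    show ?thesis using cases
      by (elim disjE) (simp_all only: 3 two lin inv fac tot_swap(1)[OF ad] pair_seqs_def list.set insert_iff simp_thms)
  qed
qed

lemma tot_pair:
  fixes p q :: "colour edge"
  assumes "p \<noteq> q"
  shows "tot {p, q} \<in> set pair_seqs"
proof -
  obtain t a b t' a' b' where pq: "p = (t, a, b)" "q = (t', a', b')" by (cases p; cases q)
  consider "t = t'" | "(t, t') \<in> {(L12, L13), (L12, R23), (L13, R23)}"
    | "(t', t) \<in> {(L12, L13), (L12, R23), (L13, R23)}"
    by (cases t; cases t'; simp)
  then show ?thesis
  proof cases
    case 1
    then have "(a, b) \<noteq> (a', b')" using assms pq by simp
    then have "tot {p, q} = two_seq" using 1 tot_same_kind[of a b a' b' t'] by (simp add: pq)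
    then show ?thesis by (simp add: pair_seqs_def)
  next
    case 2
    then show ?thesis unfolding pq by (intro tot_pair_ordered) auto
  next
    case 3
    then show ?thesis unfolding pq insert_commute[of "(t, a, b)"] by (intro tot_pair_ordered) auto
  qed
qed

lemma tot_pairs: "tot ` {E :: colour edge set. card E = 2} = set pair_seqs"
proof (intro equalityI subsetI)
  fix f assume "f \<in> tot ` {E :: colour edge set. card E = 2}"
  then obtain E :: "colour edge set" where E: "f = tot E" "card E = 2" by blast
  then obtain p q where "E = {p, q}" "p \<noteq> q" by (auto simp: card_2_iff)
  then show "f \<in> set pair_seqs" using tot_pair E(1) by simp
next
  have wb: "White \<noteq> Black" by simp
  have two: "tot {(L12, White, White), (L13, Black, Black)} = two_seq" by (rule tot_L12_L13_two[OF wb])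
  fix f assume "f \<in> set pair_seqs"
  then have "\<exists>p q. p \<noteq> q \<and> f = tot {p :: colour edge, q}"
    \<comment> \<open>Each closed form is replaced by one pair that realises it; the other six
      entries already have the form \<open>tot {p, q}\<close>.\<close>
    unfolding pair_seqs_def two[symmetric] tot_lin_1[OF wb, symmetric]
      tot_invol_1[OF wb, symmetric] tot_fact_1[OF wb, symmetric] list.set insert_iff
    by (elim disjE) (fastforce+)
  then obtain p q where "p \<noteq> q" "f = tot {p :: colour edge, q}" by blast
  then show "f \<in> tot ` {E :: colour edge set. card E = 2}"
    by (intro image_eqI[of _ _ "{p, q}"]) auto
qed

lemma tot_singles: "tot ` {E :: colour edge set. card E = 1} = {one_seq, short_seq}"
proof (intro equalityI subsetI)
  fix f assume "f \<in> tot ` {E :: colour edge set. card E = 1}"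
  then obtain p :: "colour edge" where "f = tot {p}" by (auto simp: card_1_singleton_iff)
  then show "f \<in> {one_seq, short_seq}" by (cases p) (auto simp: tot_single)
next
  fix f assume "f \<in> {one_seq, short_seq}"
  then have "f = tot {(L12, White, White)} \<or> f = tot {(L12, White, Black)}"
    by (auto simp: tot_single)
  then show "f \<in> tot ` {E :: colour edge set. card E = 1}" by auto
qed

section \<open>From counting sequences to Wilf classes\<close>

lemma card_quotient_kernel:
  "card (S // {(x, y). x \<in> S \<and> y \<in> S \<and> f x = f y}) = card (f ` S)"
proof -
  let ?r = "{(x, y). x \<in> S \<and> y \<in> S \<and> f x = f y}"
  have "S // ?r = (\<lambda>x. ?r `` {x}) ` S" by (auto simp: quotient_def)
  also have "\<dots> = (\<lambda>x. {y \<in> S. f y = f x}) ` S" by (rule image_cong) auto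
  finally have "S // ?r = (\<lambda>v. {y \<in> S. f y = v}) ` f ` S" by (simp only: image_image)
  moreover have "inj_on (\<lambda>v. {y \<in> S. f y = v}) (f ` S)"
    by (rule inj_onI) blast
  ultimately show ?thesis by (simp add: card_image)
qed

text \<open>The injection \<open>pat\<close> turns sets of edges into sets of patterns of the same
  size, and by \<open>Wilf_equivalent_iff_tot\<close> the classes are the fibres of
  \<open>tot\<close>.\<close>

lemma card_Wilf_classes:
  "card (Wilf_classes {P. P \<subseteq> (LT 3 :: 'x::finite ltree set) \<and> card P = k}) =
   card (tot ` {E :: 'x edge set. card E = k})"
proof -
  let ?S = "{P. P \<subseteq> (LT 3 :: 'x ltree set) \<and> card P = k}"
  let ?f = "\<lambda>P :: 'x ltree set. tot (pat -` P)"
  have card: "card (pat ` E) = card E" for E :: "'x edge set"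
    by (rule card_image) (meson inj_pat inj_on_subset subset_UNIV)
  have vimage: "pat -` pat ` E = E" for E :: "'x edge set"
    using inj_pat by (rule inj_vimage_image_eq)
  have S: "?S = (\<lambda>E. pat ` E) ` {E. card E = k}"
    unfolding LT_3 by (auto simp: subset_image_iff card)
  have "Wilf_equivalent P Q \<longleftrightarrow> ?f P = ?f Q" if "P \<in> ?S" "Q \<in> ?S" for P Q
    using that unfolding S by (auto simp: Wilf_equivalent_iff_tot vimage)
  then have "{(P, Q). P \<in> ?S \<and> Q \<in> ?S \<and> Wilf_equivalent P Q} =
      {(P, Q). P \<in> ?S \<and> Q \<in> ?S \<and> ?f P = ?f Q}" by blast
  then have "card (Wilf_classes ?S) = card (?f ` ?S)"
    unfolding Wilf_classes_def by (simp only: card_quotient_kernel)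
  also have "?f ` ?S = tot ` {E :: 'x edge set. card E = k}"
    unfolding S image_image vimage by (rule refl)
  finally show ?thesis .
qed

theorem mainTheorem13:
  shows "card (Wilf_classes {P. P \<subseteq> (LT 3 :: colour ltree set) \<and> card P = 1}) = 2 \<and>
         card (Wilf_classes {P. P \<subseteq> (LT 3 :: colour ltree set) \<and> card P = 2}) = 10"
proof -
  \<comment> \<open>Index 4 is the first difference: both sequences start with 0, 1, 2, 1.\<close>
  have "one_seq 4 \<noteq> short_seq 4" by (simp add: one_seq_def short_seq_def)
  then have "one_seq \<noteq> short_seq" by metis
  then show ?thesis by (simp only: card_Wilf_classes tot_singles tot_pairs card_pair_seqs) simp
qed

end
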